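(* Assume $d_I<d_H$. The stopping time $N=N(C)$ of SLINK-SEQ with parameter $C$ satisfies $$\lim_{C\to\infty}\mathbb{E}\Big[\Big|\frac{N}{C^2}-\frac1{d_H^2}\Big|\Big]=0.$$
   Context: Setting: $M\ge2$ mutually independent data sequences; sequence $i$ consists of i.i.d. samples $X^{(i)}_1,X^{(i)}_2,\dots$ from an unknown distribution $p_i$ on $\mathcal X$; $\{1,\dots,M\}$ is partitioned into $K\ge2$ nonempty true clusters $P_1,\dots,P_K$ ($K$ known). $k$ is a measurable positive-definite kernel with $0\le k\le\mathbb{G}$, $\mathcal F$ the unit ball of its RKHS, $d(p,q)=\sup_{f\in\mathcal F}(\mathbb{E}_pf-\mathbb{E}_qf)$ (MMD), $d(i,j)=d(p_i,p_j)$. Estimate: $\hat d(i,j,n)=\Big[\frac1{n^2}\sum_{l,m=1}^n\big(k(X^{(i)}_l,X^{(i)}_m)+k(X^{(j)}_l,X^{(j)}_m)-2k(X^{(i)}_l,X^{(j)}_m)\big)\Big]^{1/2}$. $d_H=\min_{k\neq l}\min_{i\in P_k,j\in P_l}d(i,j)$; $d_I(P_k)=\max\min_{i\in P_{1k},j\in P_{2k}}d(i,j)$ over partitions of $P_k$ into two nonempty disjoint sets (taken as $0$ if $|P_k|=1$); $d_I=\max_kd_I(P_k)$. SLINK with target number $K$ on dissimilarities $\delta$: start from singletons, repeatedly merge two current clusters $A\ne B$ minimizing $\min_{i\in A,j\in B}\delta(i,j)$ (ties arbitrary) until $K$ clusters remain. SLINK-SEQ with parameter $C>0$: at each time $n\ge2$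 (one new sample of every sequence per time step), run SLINK with target $K$ on $\{\hat d(i,j,n)\}$ to get clusters $C_1(n),\dots,C_K(n)$, and compute $\Gamma_n=\min_{k\neq l}\min_{i\in C_k(n),j\in C_l(n)}\hat d(i,j,n)$; the stopping time is $N=\inf\{n\ge2:\Gamma_n\ge C/\sqrt n\}$ and the output is $\{C_1(N),\dots,C_K(N)\}$. *)

theory Defs
  imports "HOL-Probability.Probability"
begin

text \<open>A finite kernel combination  g = sum_i a_i k(x_i, .)  is represented by a list of
  pairs (a_i, x_i).\<close>

definition kcomb_eval :: "('x \<Rightarrow> 'x \<Rightarrow> real) \<Rightarrow> (real \<times> 'x) list \<Rightarrow> 'x \<Rightarrow> real" where
  "kcomb_eval k g y = (\<Sum>(a,x)\<leftarrow>g. a * k x y)"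

definition kcomb_norm2 :: "('x \<Rightarrow> 'x \<Rightarrow> real) \<Rightarrow> (real \<times> 'x) list \<Rightarrow> real" where
  "kcomb_norm2 k g = (\<Sum>(a,x)\<leftarrow>g. \<Sum>(b,z)\<leftarrow>g. a * b * k x z)"

definition kcomb_diff :: "(real \<times> 'x) list \<Rightarrow> (real \<times> 'x) list \<Rightarrow> (real \<times> 'x) list" where
  "kcomb_diff g h = g @ map (\<lambda>(b,z). (- b, z)) h"

definition pd_kernel :: "('x \<Rightarrow> 'x \<Rightarrow> real) \<Rightarrow> bool" where
  "pd_kernel k \<longleftrightarrow> (\<forall>x y. k x y = k y x) \<and> (\<forall>g. kcomb_norm2 k g \<ge> 0)"

text \<open>Unit ball of the RKHS of k (Moore--Aronszajn construction): f belongs to it iff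
  f is the pointwise limit of an RKHS-Cauchy sequence of finite kernel combinations
  whose RKHS norms tend to a limit at most 1.\<close>
definition rkhs_unit_ball :: "('x \<Rightarrow> 'x \<Rightarrow> real) \<Rightarrow> ('x \<Rightarrow> real) set" where
  "rkhs_unit_ball k = {f. \<exists>g :: nat \<Rightarrow> (real \<times> 'x) list.
      (\<forall>e>0. \<exists>N. \<forall>m\<ge>N. \<forall>n\<ge>N. kcomb_norm2 k (kcomb_diff (g m) (g n)) < e) \<and>
      (\<forall>y. (\<lambda>n. kcomb_eval k (g n) y) \<longlonglongrightarrow> f y) \<and>
      (\<exists>L. (\<lambda>n. kcomb_norm2 k (g n)) \<longlonglongrightarrow> L \<and> L \<le> 1)}"

definition mmd :: "('x \<Rightarrow> 'x \<Rightarrow> real) \<Rightarrow> 'x measure \<Rightarrow> 'x measure \<Rightarrow> real" where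
  "mmd k p q = Sup {(\<integral>x. f x \<partial>p) - (\<integral>x. f x \<partial>q) | f. f \<in> rkhs_unit_ball k}"

definition linkage :: "(nat \<Rightarrow> nat \<Rightarrow> real) \<Rightarrow> nat set \<Rightarrow> nat set \<Rightarrow> real" where
  "linkage \<delta> A B = Min {\<delta> i j | i j. i \<in> A \<and> j \<in> B}"

definition d_H :: "(nat \<Rightarrow> nat \<Rightarrow> real) \<Rightarrow> nat set set \<Rightarrow> real" where
  "d_H \<delta> P = Min {linkage \<delta> A B | A B. A \<in> P \<and> B \<in> P \<and> A \<noteq> B}"

definition d_I_cluster :: "(nat \<Rightarrow> nat \<Rightarrow> real) \<Rightarrow> nat set \<Rightarrow> real" where
  "d_I_cluster \<delta> A = (if card A = 1 then 0 else
     Max {linkage \<delta> A1 A2 | A1 A2. A1 \<noteq> {} \<and> A2 \<noteq> {} \<and> A1 \<inter> A2 = {} \<and> A1 \<union> A2 = A})"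

definition d_I :: "(nat \<Rightarrow> nat \<Rightarrow> real) \<Rightarrow> nat set set \<Rightarrow> real" where
  "d_I \<delta> P = Max (d_I_cluster \<delta> ` P)"

definition slink_step :: "(nat \<Rightarrow> nat \<Rightarrow> real) \<Rightarrow> nat set set \<Rightarrow> nat set set \<Rightarrow> bool" where
  "slink_step \<delta> Cs Cs' \<longleftrightarrow> (\<exists>A\<in>Cs. \<exists>B\<in>Cs. A \<noteq> B \<and>
      (\<forall>A'\<in>Cs. \<forall>B'\<in>Cs. A' \<noteq> B' \<longrightarrow> linkage \<delta> A B \<le> linkage \<delta> A' B') \<and>
      Cs' = insert (A \<union> B) (Cs - {A, B}))"

definition slink_output :: "(nat \<Rightarrow> nat \<Rightarrow> real) \<Rightarrow> nat \<Rightarrow> nat \<Rightarrow> nat set set \<Rightarrow> bool" where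
  "slink_output \<delta> m K Cs \<longleftrightarrow>
     (slink_step \<delta>)\<^sup>*\<^sup>* ((\<lambda>i. {i}) ` {..<m}) Cs \<and> card Cs = K"

definition slink_gap :: "(nat \<Rightarrow> nat \<Rightarrow> real) \<Rightarrow> nat set set \<Rightarrow> real" where
  "slink_gap \<delta> Cs = Min {linkage \<delta> A B | A B. A \<in> Cs \<and> B \<in> Cs \<and> A \<noteq> B}"

text \<open>X i l is the (l+1)-th sample of sequence i; at time n the samples l < n are used.\<close>
definition dhat :: "('x \<Rightarrow> 'x \<Rightarrow> real) \<Rightarrow> (nat \<Rightarrow> nat \<Rightarrow> 'w \<Rightarrow> 'x) \<Rightarrow> nat \<Rightarrow> 'w \<Rightarrow> nat \<Rightarrow> nat \<Rightarrow> real" where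
  "dhat k X n \<omega> i j = sqrt ((1 / (real n)^2) * (\<Sum>l<n. \<Sum>l'<n.
      k (X i l \<omega>) (X i l' \<omega>) + k (X j l \<omega>) (X j l' \<omega>) - 2 * k (X i l \<omega>) (X j l' \<omega>)))"

text \<open>Stopping time of SLINK-SEQ (infinity if the stopping condition never holds);
  sel is the (arbitrary tie-breaking) implementation of SLINK.\<close>
definition slink_seq_N :: "('x \<Rightarrow> 'x \<Rightarrow> real) \<Rightarrow> (nat \<Rightarrow> nat \<Rightarrow> 'w \<Rightarrow> 'x) \<Rightarrow>
    ((nat \<Rightarrow> nat \<Rightarrow> real) \<Rightarrow> nat set set) \<Rightarrow> real \<Rightarrow> 'w \<Rightarrow> enat" where
  "slink_seq_N k X sel C \<omega> =
     (let stop = (\<lambda>n. 2 \<le> n \<and> slink_gap (dhat k X n \<omega>) (sel (dhat k X n \<omega>)) \<ge> C / sqrt (real n))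
      in if \<exists>n. stop n then enat (LEAST n. stop n) else \<infinity>)"

definition stop_error :: "enat \<Rightarrow> real \<Rightarrow> real \<Rightarrow> ennreal" where
  "stop_error N C dH = (case N of enat n \<Rightarrow> ennreal \<bar>real n / C^2 - 1 / dH^2\<bar> | \<infinity> \<Rightarrow> \<infinity>)"

end

theory Submission
  imports Defs "HOL-Real_Asymp.Real_Asymp"
begin

text \<open>
  The maximum mean discrepancy d(i,j) is the limit of the estimates along almost every sample path:
  by the Cauchy--Schwarz inequality for kernel combinations no function of the unit ball separates
  the two empirical measures by more than the estimate, and the normalised difference of the
  empirical mean embeddings is asymptotically optimal. The estimates are square roots of averages of
  the kernel over pairs of samples. Conditioning on the first point of a pair and applying
  Hoeffding's inequality shows that their deviation probabilities are summable, so the number V of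
  times at which some estimate is off by at least e has finite expectation.

  At every other time SLINK recovers the true clusters and the gap lies within e of \<open>d_H\<close>.
  Hence N is at most \<open>C\<^sup>2/(d_H - e)\<^sup>2 + 3 + V\<close>, and N is at least \<open>C\<^sup>2/(d_H + e)\<^sup>2\<close> unless N is
  itself a bad time. As the estimates are bounded, N is large when C is large, so the latter event is
  controlled by the tail of the sum of the deviation probabilities.
\<close>

subsection \<open>Kernel combinations\<close>

text \<open>For \<open>pd_kernel k\<close> this is a positive semidefinite form on lists; distinct
  lists may represent the same function, and no quotient is ever formed.\<close>

definition kcomb_inner :: "('x \<Rightarrow> 'x \<Rightarrow> real) \<Rightarrow> (real \<times> 'x) list \<Rightarrow> (real \<times> 'x) list \<Rightarrow> real" where
  "kcomb_inner k g h = (\<Sum>(a,x)\<leftarrow>g. \<Sum>(b,z)\<leftarrow>h. a * b * k x z)"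

definition kcomb_scale :: "real \<Rightarrow> (real \<times> 'x) list \<Rightarrow> (real \<times> 'x) list" where
  "kcomb_scale t g = map (\<lambda>(a,x). (t * a, x)) g"

lemma kcomb_norm2_eq_inner: "kcomb_norm2 k g = kcomb_inner k g g"
  by (simp add: kcomb_norm2_def kcomb_inner_def)

lemma kcomb_eval_simps [simp]:
  "kcomb_eval k [] y = 0"
  "kcomb_eval k ((a, x) # g) y = a * k x y + kcomb_eval k g y"
  "kcomb_eval k (g @ h) y = kcomb_eval k g y + kcomb_eval k h y"
  by (simp_all add: kcomb_eval_def)

lemma kcomb_eval_scale [simp]: "kcomb_eval k (kcomb_scale t g) y = t * kcomb_eval k g y"
  by (induction g) (auto simp: kcomb_scale_def algebra_simps)

lemma kcomb_inner_Nil [simp]: "kcomb_inner k [] h = 0" "kcomb_inner k g [] = 0"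
  by (induction g) (auto simp: kcomb_inner_def)

lemma kcomb_inner_Cons_right:
  "kcomb_inner k g ((b, z) # h) = b * kcomb_eval k g z + kcomb_inner k g h"
  by (induction g) (auto simp: kcomb_inner_def algebra_simps)

text \<open>The reproducing property. In this form the left argument enters only through its values
  at finitely many points, so pointwise limits can be taken.\<close>

lemma kcomb_inner_eval: "kcomb_inner k g h = (\<Sum>(b,z)\<leftarrow>h. b * kcomb_eval k g z)"
  by (induction h) (auto simp: kcomb_inner_Cons_right)

lemma kcomb_inner_append_right:
  "kcomb_inner k g (h1 @ h2) = kcomb_inner k g h1 + kcomb_inner k g h2"
  by (simp add: kcomb_inner_eval)

lemma kcomb_inner_append_left:
  "kcomb_inner k (g1 @ g2) h = kcomb_inner k g1 h + kcomb_inner k g2 h"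
  by (simp add: kcomb_inner_def)

lemma kcomb_inner_scale_left: "kcomb_inner k (kcomb_scale t g) h = t * kcomb_inner k g h"
  by (induction h) (auto simp: kcomb_inner_Cons_right algebra_simps)

lemma kcomb_inner_scale_right: "kcomb_inner k g (kcomb_scale t h) = t * kcomb_inner k g h"
  by (induction h) (auto simp: kcomb_inner_Cons_right kcomb_scale_def algebra_simps)

lemma kcomb_inner_Cons_left:
  assumes "\<And>x y. k x y = k y x"
  shows "kcomb_inner k ((a, x) # g) h = a * kcomb_eval k h x + kcomb_inner k g h"
  by (induction h) (auto simp: kcomb_inner_Cons_right algebra_simps assms[of x])

lemma kcomb_inner_commute:
  assumes "\<And>x y. k x y = k y x"
  shows "kcomb_inner k g h = kcomb_inner k h g"
proof (induction g)
  case (Cons ax g)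
  then show ?case
    by (cases ax) (simp add: kcomb_inner_Cons_right kcomb_inner_Cons_left[of k, OF assms])
qed simp

lemma kcomb_diff_eq: "kcomb_diff g h = g @ kcomb_scale (-1) h"
  by (simp add: kcomb_diff_def kcomb_scale_def case_prod_beta)

lemma kcomb_norm2_nonneg: "pd_kernel k \<Longrightarrow> 0 \<le> kcomb_norm2 k g"
  by (simp add: pd_kernel_def)

lemma pd_kernel_commute: "pd_kernel k \<Longrightarrow> k x y = k y x"
  by (simp add: pd_kernel_def)

lemma kcomb_norm2_add_scale:
  assumes "pd_kernel k"
  shows "kcomb_norm2 k (g @ kcomb_scale t h)
       = kcomb_norm2 k g + 2 * t * kcomb_inner k g h + t\<^sup>2 * kcomb_norm2 k h"
  using kcomb_inner_commute[of k h g] pd_kernel_commute[OF assms]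
  by (simp add: kcomb_norm2_eq_inner kcomb_inner_append_left kcomb_inner_append_right
      kcomb_inner_scale_left kcomb_inner_scale_right algebra_simps power2_eq_square)

lemma kcomb_norm2_scale: "kcomb_norm2 k (kcomb_scale t g) = t\<^sup>2 * kcomb_norm2 k g"
  by (simp add: kcomb_norm2_eq_inner kcomb_inner_scale_left kcomb_inner_scale_right power2_eq_square)

lemma quadratic_nonneg_discriminant:
  fixes a b c :: real
  assumes "\<And>t. 0 \<le> a + 2 * t * b + t\<^sup>2 * c" and "0 \<le> c"
  shows "b\<^sup>2 \<le> a * c"
proof (cases "c = 0")
  case True
  have "b = 0"
  proof (rule ccontr)
    assume "b \<noteq> 0"
    \<comment> \<open>For \<open>c = 0\<close> the quadratic is affine in \<open>t\<close>, and this
      \<open>t\<close> gives it the value -1.\<close>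
    with assms(1)[of "- (a + 1) / (2 * b)"] True show False
      by (simp add: field_simps)
  qed
  with True show ?thesis by simp
next
  case False
  with assms have "0 < c" by simp
  \<comment> \<open>\<open>- b / c\<close> minimises the quadratic.\<close>
  have "0 \<le> a + 2 * (- b / c) * b + (- b / c)\<^sup>2 * c" by (rule assms)
  also have "\<dots> = a - b\<^sup>2 / c"
    using \<open>0 < c\<close> by (simp add: field_simps power2_eq_square)
  finally show ?thesis
    using \<open>0 < c\<close> by (simp add: field_simps)
qed

text \<open>The squared norm of \<open>g + t h\<close> is a nonnegative quadratic in
  \<open>t\<close>. The discriminant argument also covers nonempty \<open>h\<close> of norm
  zero.\<close>

lemma kcomb_Cauchy_Schwarz:
  assumes "pd_kernel k"
  shows "(kcomb_inner k g h)\<^sup>2 \<le> kcomb_norm2 k g * kcomb_norm2 k h"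
  by (rule quadratic_nonneg_discriminant)
     (use kcomb_norm2_nonneg[OF assms] kcomb_norm2_add_scale[OF assms] in \<open>metis\<close>)+

text \<open>Cauchy--Schwarz for the approximating combinations passes to the limit, because the
  pairing sees \<open>f\<close> only at the finitely many centres of \<open>h\<close>.\<close>

lemma rkhs_unit_ball_pairing_le:
  assumes k: "pd_kernel k" and f: "f \<in> rkhs_unit_ball k"
  shows "\<bar>\<Sum>(b,z)\<leftarrow>h. b * f z\<bar> \<le> sqrt (kcomb_norm2 k h)"
proof -
  from f obtain g L where g: "\<And>y. (\<lambda>n. kcomb_eval k (g n) y) \<longlonglongrightarrow> f y"
    and L: "(\<lambda>n. kcomb_norm2 k (g n)) \<longlonglongrightarrow> L" "L \<le> 1"
    unfolding rkhs_unit_ball_def by auto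
  have "(\<lambda>n. \<Sum>(b,z)\<leftarrow>h. b * kcomb_eval k (g n) z) \<longlonglongrightarrow> (\<Sum>(b,z)\<leftarrow>h. b * f z)"
    by (induction h) (auto intro!: tendsto_intros g)
  then have lim: "(\<lambda>n. (kcomb_inner k (g n) h)\<^sup>2) \<longlonglongrightarrow> (\<Sum>(b,z)\<leftarrow>h. b * f z)\<^sup>2"
    unfolding kcomb_inner_eval by (rule tendsto_power)
  have "(\<Sum>(b,z)\<leftarrow>h. b * f z)\<^sup>2 \<le> L * kcomb_norm2 k h"
    by (rule tendsto_le[OF _ tendsto_mult_right[OF L(1)] lim])
       (auto intro: always_eventually kcomb_Cauchy_Schwarz[OF k])
  also have "\<dots> \<le> kcomb_norm2 k h"
    using mult_right_mono[OF L(2) kcomb_norm2_nonneg[OF k, of h]] by simp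
  finally show ?thesis
    using real_sqrt_le_mono by fastforce
qed

lemma rkhs_unit_ball_abs_le:
  assumes "pd_kernel k" "f \<in> rkhs_unit_ball k"
  shows "\<bar>f y\<bar> \<le> sqrt (k y y)"
  using rkhs_unit_ball_pairing_le[OF assms, of "[(1, y)]"] by (simp add: kcomb_norm2_def)

lemma kcomb_eval_in_rkhs_unit_ball:
  assumes "pd_kernel k" "kcomb_norm2 k g \<le> 1"
  shows "kcomb_eval k g \<in> rkhs_unit_ball k"
proof -
  have "kcomb_norm2 k (kcomb_diff g g) = 0"
    using kcomb_norm2_add_scale[OF assms(1), of g "-1" g]
    by (simp add: kcomb_diff_eq kcomb_norm2_eq_inner)
  then show ?thesis
    using assms(2) unfolding rkhs_unit_ball_def by (intro CollectI exI[of _ "\<lambda>_. g"]) auto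
qed

text \<open>The difference of the empirical mean embeddings of the first n points of two sequences.\<close>

definition emp_diff :: "nat \<Rightarrow> (nat \<Rightarrow> 'x) \<Rightarrow> (nat \<Rightarrow> 'x) \<Rightarrow> (real \<times> 'x) list" where
  "emp_diff n x y = map (\<lambda>l. (1 / real n, x l)) [0..<n] @ map (\<lambda>l. (- 1 / real n, y l)) [0..<n]"

lemma emp_diff_pairing:
  "(\<Sum>(b,z)\<leftarrow>emp_diff n x y. b * f z) = (\<Sum>l<n. f (x l)) / n - (\<Sum>l<n. f (y l)) / n"
  by (simp add: emp_diff_def interv_sum_list_conv_sum_set_nat atLeast0LessThan o_def
      sum_divide_distrib sum_negf)

lemma kcomb_eval_emp_diff:
  "kcomb_eval k (emp_diff n x y) z = (\<Sum>l<n. k (x l) z) / n - (\<Sum>l<n. k (y l) z) / n"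
  unfolding kcomb_eval_def by (rule emp_diff_pairing[where f = "\<lambda>x. k x z"])

lemma kcomb_norm2_emp_diff:
  assumes "pd_kernel k"
  shows "kcomb_norm2 k (emp_diff n x y) = 1 / (real n)\<^sup>2 * (\<Sum>l<n. \<Sum>l'<n.
      k (x l) (x l') + k (y l) (y l') - 2 * k (x l) (y l'))"
proof -
  \<comment> \<open>Cross terms occur with either sequence in the first slot. Kernel symmetry
    identifies them, while the other rearrangements only exchange sums.\<close>
  have sw: "(\<Sum>l<n. \<Sum>l'<n. k (y l') (x l)) = (\<Sum>l<n. \<Sum>l'<n. k (x l) (y l'))"
    by (simp add: pd_kernel_commute[OF assms])
  have sx: "(\<Sum>l<n. \<Sum>l'<n. k (x l') (x l)) = (\<Sum>l<n. \<Sum>l'<n. k (x l) (x l'))"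
    by (rule sum.swap)
  have sy: "(\<Sum>l<n. \<Sum>l'<n. k (y l') (y l)) = (\<Sum>l<n. \<Sum>l'<n. k (y l) (y l'))"
    by (rule sum.swap)
  have sz: "(\<Sum>l<n. \<Sum>l'<n. k (x l') (y l)) = (\<Sum>l<n. \<Sum>l'<n. k (x l) (y l'))"
    by (rule sum.swap)
  show ?thesis
    unfolding kcomb_norm2_eq_inner kcomb_inner_eval emp_diff_pairing kcomb_eval_emp_diff
    by (simp add: sum_subtractf sum.distrib sw sx sy sz diff_divide_distrib add_divide_distrib
        sum_divide_distrib[symmetric] sum_distrib_left[symmetric] power2_eq_square)
qed

text \<open>The estimate is the RKHS distance between the empirical mean embeddings. This links it
  to the maximum mean discrepancy and shows that the radicand is nonnegative.\<close>

lemma dhat_eq_norm_emp_diff: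
  assumes "pd_kernel k"
  shows "dhat k X n \<omega> i j = sqrt (kcomb_norm2 k (emp_diff n (\<lambda>l. X i l \<omega>) (\<lambda>l. X j l \<omega>)))"
  unfolding dhat_def kcomb_norm2_emp_diff[OF assms] ..

subsection \<open>Complete convergence of sample averages\<close>

context prob_space
begin

text \<open>Hsu--Robbins complete convergence: unlike almost sure convergence, it makes the expected
  number of times with a large deviation finite.\<close>

definition completely_tendsto :: "(nat \<Rightarrow> 'a \<Rightarrow> real) \<Rightarrow> real \<Rightarrow> bool" where
  "completely_tendsto Y c \<longleftrightarrow> (\<forall>n. Y n \<in> borel_measurable M) \<and>
     (\<forall>e>0. summable (\<lambda>n. prob {\<omega> \<in> space M. e \<le> \<bar>Y n \<omega> - c\<bar>}))"

lemma completely_tendsto_measurable: "completely_tendsto Y c \<Longrightarrow> Y n \<in> borel_measurable M"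
  by (simp add: completely_tendsto_def)

text \<open>Borel--Cantelli for each threshold \<open>1 / Suc j\<close>; countably many thresholds
  suffice for convergence.\<close>

lemma completely_tendsto_AE:
  assumes "completely_tendsto Y c"
  shows "AE \<omega> in M. (\<lambda>n. Y n \<omega>) \<longlonglongrightarrow> c"
proof -
  have [measurable]: "Y n \<in> borel_measurable M" for n
    using assms by (rule completely_tendsto_measurable)
  have "AE \<omega> in M. eventually (\<lambda>n. \<omega> \<in> space M - {\<omega> \<in> space M. 1 / real (Suc j) \<le> \<bar>Y n \<omega> - c\<bar>}) sequentially" for j
    by (rule borel_cantelli_AE1) (use assms in \<open>auto simp: completely_tendsto_def less_top[symmetric]\<close>)
  then have "AE \<omega> in M. \<forall>j. eventually (\<lambda>n. \<omega> \<in> space M - {\<omega> \<in> space M. 1 / real (Suc j) \<le> \<bar>Y n \<omega> - c\<bar>}) sequentially"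
    unfolding AE_all_countable by blast
  then show ?thesis
  proof (rule AE_mp, intro AE_I2 impI)
    fix \<omega> assume \<omega>: "\<forall>j. eventually (\<lambda>n. \<omega> \<in> space M - {\<omega> \<in> space M. 1 / real (Suc j) \<le> \<bar>Y n \<omega> - c\<bar>}) sequentially"
    show "(\<lambda>n. Y n \<omega>) \<longlonglongrightarrow> c"
    proof (rule tendstoI)
      fix e :: real assume "0 < e"
      then obtain j where j: "1 / real (Suc j) < e"
        using nat_approx_posE by blast
      from \<omega> have "eventually (\<lambda>n. \<omega> \<in> space M - {\<omega> \<in> space M. 1 / real (Suc j) \<le> \<bar>Y n \<omega> - c\<bar>}) sequentially" by blast
      then show "eventually (\<lambda>n. dist (Y n \<omega>) c < e) sequentially"
        by eventually_elim (use j in \<open>auto simp: dist_real_def\<close>)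
    qed
  qed
qed

text \<open>Relations between deterministic limits are proved below along a single sample path,
  which this lemma provides.\<close>

lemma AE_witness:
  assumes "AE \<omega> in M. Q \<omega>"
  obtains \<omega> where "\<omega> \<in> space M" "Q \<omega>"
proof -
  have "\<not> (AE \<omega> in M. False)" by simp
  then show ?thesis using assms that by (metis (mono_tags, lifting) AE_mp AE_I2)
qed

text \<open>A union bound. In \<open>close\<close> the tolerance \<open>d\<close> does not depend on
  the time or the path, so for large \<open>n\<close> a deviation of \<open>Z\<close> forces a
  deviation of one of the finitely many \<open>Y i\<close>.\<close>

lemma completely_tendsto_transfer:
  assumes "finite I" and Y: "\<And>i. i \<in> I \<Longrightarrow> completely_tendsto (Y i) (c i)"
    and Z [measurable]: "\<And>n. Z n \<in> borel_measurable M"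
    and close: "\<And>e. 0 < e \<Longrightarrow> \<exists>d>0. \<forall>\<^sub>F n in sequentially. \<forall>\<omega>\<in>space M.
       (\<forall>i\<in>I. \<bar>Y i n \<omega> - c i\<bar> < d) \<longrightarrow> \<bar>Z n \<omega> - z\<bar> < e"
  shows "completely_tendsto Z z"
  unfolding completely_tendsto_def
proof (intro conjI allI impI)
  fix e :: real assume "0 < e"
  from close[OF this] obtain d where d: "0 < d"
    and ev: "\<forall>\<^sub>F n in sequentially. \<forall>\<omega>\<in>space M.
       (\<forall>i\<in>I. \<bar>Y i n \<omega> - c i\<bar> < d) \<longrightarrow> \<bar>Z n \<omega> - z\<bar> < e" by blast
  have m: "{\<omega> \<in> space M. d \<le> \<bar>Y i n \<omega> - c i\<bar>} \<in> events" if "i \<in> I" for i n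
    using completely_tendsto_measurable[OF Y[OF that]] by measurable
  have "\<forall>\<^sub>F n in sequentially. norm (prob {\<omega> \<in> space M. e \<le> \<bar>Z n \<omega> - z\<bar>})
      \<le> (\<Sum>i\<in>I. prob {\<omega> \<in> space M. d \<le> \<bar>Y i n \<omega> - c i\<bar>})"
    using ev
  proof eventually_elim
    case (elim n)
    have "prob {\<omega> \<in> space M. e \<le> \<bar>Z n \<omega> - z\<bar>}
        \<le> prob (\<Union>i\<in>I. {\<omega> \<in> space M. d \<le> \<bar>Y i n \<omega> - c i\<bar>})"
      using elim \<open>finite I\<close> m by (intro finite_measure_mono) (auto simp: not_le[symmetric])
    also have "\<dots> \<le> (\<Sum>i\<in>I. prob {\<omega> \<in> space M. d \<le> \<bar>Y i n \<omega> - c i\<bar>})"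
      using \<open>finite I\<close> m by (intro finite_measure_subadditive_finite) auto
    finally show ?case by simp
  qed
  then show "summable (\<lambda>n. prob {\<omega> \<in> space M. e \<le> \<bar>Z n \<omega> - z\<bar>})"
    by (rule summable_comparison_test_ev)
       (use Y d in \<open>auto intro!: summable_sum simp: completely_tendsto_def\<close>)
qed (rule Z)

text \<open>Fubini for the joint law, which independence makes a product: a bound valid for every
  section of \<open>E\<close> survives averaging over \<open>Y\<close>.\<close>

lemma prob_indep_pair_le:
  assumes ind: "indep_var S Y T Z" and E: "E \<in> sets (S \<Otimes>\<^sub>M T)"
    and le: "\<And>y. y \<in> space S \<Longrightarrow> prob {\<omega> \<in> space M. (y, Z \<omega>) \<in> E} \<le> c"
  shows "prob {\<omega> \<in> space M. (Y \<omega>, Z \<omega>) \<in> E} \<le> c"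
proof -
  from ind have Y [measurable]: "Y \<in> measurable M S" and Z [measurable]: "Z \<in> measurable M T"
    and eq: "distr M S Y \<Otimes>\<^sub>M distr M T Z = distr M (S \<Otimes>\<^sub>M T) (\<lambda>x. (Y x, Z x))"
    unfolding indep_var_distribution_eq by auto
  obtain \<omega> where "\<omega> \<in> space M" using not_empty by blast
  then have "0 \<le> c" using le[of "Y \<omega>"] measurable_space[OF Y] by (meson measure_nonneg order_trans)
  interpret Y: prob_space "distr M S Y" by (rule prob_space_distr) fact
  interpret Z: prob_space "distr M T Z" by (rule prob_space_distr) fact
  have "{\<omega> \<in> space M. (Y \<omega>, Z \<omega>) \<in> E} = (\<lambda>\<omega>. (Y \<omega>, Z \<omega>)) -` E \<inter> space M" by auto
  then have "emeasure M {\<omega> \<in> space M. (Y \<omega>, Z \<omega>) \<in> E} = emeasure (distr M (S \<Otimes>\<^sub>M T) (\<lambda>x. (Y x, Z x))) E"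
    using E by (simp add: emeasure_distr)
  also have "\<dots> = (\<integral>\<^sup>+y. emeasure (distr M T Z) (Pair y -` E) \<partial>distr M S Y)"
    unfolding eq[symmetric] using E by (intro Z.emeasure_pair_measure_alt) simp
  also have "\<dots> \<le> (\<integral>\<^sup>+y. ennreal c \<partial>distr M S Y)"
  proof (rule nn_integral_mono)
    fix y assume y: "y \<in> space (distr M S Y)"
    have "emeasure (distr M T Z) (Pair y -` E) = emeasure M {\<omega> \<in> space M. (y, Z \<omega>) \<in> E}"
      using E by (subst emeasure_distr) (auto intro!: arg_cong[where f = "emeasure M"] sets_Pair1)
    also have "\<dots> \<le> ennreal c"
      using le y by (simp add: emeasure_eq_measure ennreal_leI)
    finally show "emeasure (distr M T Z) (Pair y -` E) \<le> ennreal c" .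
  qed
  also have "\<dots> = ennreal c" by (simp add: Y.emeasure_space_1[simplified])
  finally show ?thesis using \<open>0 \<le> c\<close> by (simp add: emeasure_eq_measure)
qed

end

text \<open>The derivative of the geometric series. The factor \<open>n + 1\<close> will come from a
  union bound over \<open>n\<close> rows and one further event.\<close>

lemma summable_poly_geometric:
  fixes r :: real
  assumes "0 \<le> r" "r < 1"
  shows "summable (\<lambda>n. (real n + 1) * r ^ n)"
  using geometric_deriv_sums[of r] assms by (auto simp: sums_iff add.commute)

section \<open>Exponential deviation bounds for independent samples\<close>

locale iid_sequences = prob_space M for M :: "'w measure" +
  fixes S :: "'x measure" and X :: "nat \<Rightarrow> nat \<Rightarrow> 'w \<Rightarrow> 'x" and p :: "nat \<Rightarrow> 'x measure" and m :: nat
  assumes indep: "indep_vars (\<lambda>_. S) (\<lambda>(i, l). X i l) ({..<m} \<times> UNIV)"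
    and distr_X: "i < m \<Longrightarrow> distr M S (X i l) = p i"
begin

lemma X_measurable: "i < m \<Longrightarrow> X i l \<in> measurable M S"
  using indep unfolding indep_vars_def by force

lemma sets_p: "i < m \<Longrightarrow> sets (p i) = sets S"
  using distr_X[of i 0, symmetric] by simp

lemma space_p: "i < m \<Longrightarrow> space (p i) = space S"
  by (rule sets_eq_imp_space_eq) (rule sets_p)

lemma prob_space_p: "i < m \<Longrightarrow> prob_space (p i)"
  using prob_space_distr[OF X_measurable, of i 0] distr_X[of i 0] by simp

lemma expectation_X:
  fixes f :: "'x \<Rightarrow> real"
  assumes "i < m" "f \<in> borel_measurable S"
  shows "expectation (\<lambda>\<omega>. f (X i l \<omega>)) = (\<integral>x. f x \<partial>p i)"
  using integral_distr[OF X_measurable[OF assms(1)] assms(2), of l] distr_X[OF assms(1), of l] by simp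

lemma integrable_p:
  fixes f :: "'x \<Rightarrow> real"
  assumes "i < m" "f \<in> borel_measurable S" "\<And>x. x \<in> space S \<Longrightarrow> \<bar>f x\<bar> \<le> b"
  shows "integrable (p i) f"
proof -
  interpret P: prob_space "p i" by (rule prob_space_p) fact
  show ?thesis
    by (rule P.integrable_const_bound[of _ b])
       (use assms in \<open>auto simp: space_p measurable_cong_sets[OF sets_p refl] intro!: AE_I2\<close>)
qed

lemma abs_integral_p_le:
  fixes f :: "'x \<Rightarrow> real"
  assumes "i < m" "f \<in> borel_measurable S" "\<And>x. x \<in> space S \<Longrightarrow> \<bar>f x\<bar> \<le> b"
  shows "\<bar>\<integral>x. f x \<partial>p i\<bar> \<le> b"
proof -
  interpret P: prob_space "p i" by (rule prob_space_p) fact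
  have int: "integrable (p i) f" using assms by (rule integrable_p)
  have "\<bar>\<integral>x. f x \<partial>p i\<bar> \<le> (\<integral>x. \<bar>f x\<bar> \<partial>p i)" by (rule integral_abs_bound)
  also have "\<dots> \<le> (\<integral>x. b \<partial>p i)"
    using assms int by (intro integral_mono) (auto simp: space_p)
  finally show ?thesis by (simp add: P.prob_space)
qed

text \<open>Summing fewer than \<open>n\<close> terms only improves the exponent, so the bound can
  be stated in \<open>n\<close> alone. It then serves full samples and rows with one index removed
  alike.\<close>

lemma Hoeffding_sample_sum:
  fixes f :: "'x \<Rightarrow> real"
  assumes i: "i < m" and f [measurable]: "f \<in> borel_measurable S"
    and b: "\<And>x. x \<in> space S \<Longrightarrow> \<bar>f x\<bar> \<le> b" "0 < b"
    and J: "finite J" "card J \<le> n" and e: "0 < e"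
  shows "prob {\<omega> \<in> space M. n * e \<le> \<bar>\<Sum>l\<in>J. f (X i l \<omega>) - (\<integral>x. f x \<partial>p i)\<bar>}
    \<le> 2 * exp (- (e\<^sup>2 / (2 * b\<^sup>2))) ^ n"
\<comment> \<open>Hoeffding's inequality needs a positive sum of squared widths. In the excluded
  cases the bound is 2 (\<open>n = 0\<close>) or the event is empty.\<close>
proof (cases "J = {} \<or> n = 0")
  case True
  have "prob A \<le> 2" for A using prob_le_1[of A] by linarith
  then show ?thesis
    using True J(1) e J(2) by (cases "n = 0") (auto simp: mult_le_0_iff)
next
  case False
  define I where "I = Pair i ` J"
  define Y where "Y = (\<lambda>il \<omega>. f (X (fst il) (snd il) \<omega>))"
  define c where "c = card J"
  have c: "0 < c" "c \<le> n" "0 < n" using False J by (auto simp: c_def card_gt_0_iff)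
  have "indep_vars (\<lambda>_. S) (\<lambda>(i, l). X i l) I"
    using indep by (rule indep_vars_subset) (use i in \<open>auto simp: I_def\<close>)
  then have "indep_vars (\<lambda>_. borel) (\<lambda>il \<omega>. f ((case il of (i, l) \<Rightarrow> X i l) \<omega>)) I"
    by (rule indep_vars_compose2) (rule f)
  then have ind: "indep_vars (\<lambda>_. borel) Y I"
    by (simp add: Y_def case_prod_beta)
  interpret H: Hoeffding_ineq M I Y "\<lambda>_. - b" "\<lambda>_. b" "\<Sum>j\<in>I. expectation (Y j)"
  proof unfold_locales
    fix j assume "j \<in> I"
    then show "AE \<omega> in M. Y j \<omega> \<in> {- b..b}"
      using b(1)[OF measurable_space[OF X_measurable[OF i]]]
      by (intro AE_I2) (auto simp: I_def Y_def abs_le_iff minus_le_iff)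
  qed (use J ind in \<open>auto simp: I_def\<close>)
  have cI: "card I = c" unfolding I_def c_def by (rule card_image) (auto simp: inj_on_def)
  have sI: "(\<Sum>j\<in>I. g j) = (\<Sum>l\<in>J. g (i, l))" for g :: "nat \<times> nat \<Rightarrow> real"
    unfolding I_def by (subst sum.reindex) (auto simp: inj_on_def)
  have "prob {\<omega> \<in> space M. n * e \<le> \<bar>\<Sum>l\<in>J. f (X i l \<omega>) - (\<integral>x. f x \<partial>p i)\<bar>}
    = prob {\<omega> \<in> space M. n * e \<le> \<bar>(\<Sum>j\<in>I. Y j \<omega>) - (\<Sum>j\<in>I. expectation (Y j))\<bar>}"
    by (simp add: sI Y_def expectation_X[OF i f] sum_subtractf)
  also have "\<dots> \<le> 2 * exp (- 2 * (n * e)\<^sup>2 / (\<Sum>j\<in>I. (b - - b)\<^sup>2))"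
    using c e b by (intro H.Hoeffding_ineq_abs_ge) (auto simp: cI)
  \<comment> \<open>Each summand ranges over an interval of width \<open>2 * b\<close>, and
    \<open>card J \<le> n\<close> lets one factor \<open>n\<close> cancel.\<close>
  also have "- 2 * (n * e)\<^sup>2 / (\<Sum>j\<in>I. (b - - b)\<^sup>2) \<le> real n * (- (e\<^sup>2 / (2 * b\<^sup>2)))"
  proof -
    have "real c * real n \<le> real n * real n" using c by (intro mult_right_mono) auto
    then have "(real c * real n) * (e\<^sup>2 * b\<^sup>2) \<le> (real n * real n) * (e\<^sup>2 * b\<^sup>2)"
      by (rule mult_right_mono) simp
    then show ?thesis
      using c b(2) by (simp add: cI field_simps power2_eq_square)
  qed
  finally show ?thesis unfolding exp_of_nat_mult by simp
qed

lemma sample_mean_completely_tendsto: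
  fixes f :: "'x \<Rightarrow> real"
  assumes i: "i < m" and f [measurable]: "f \<in> borel_measurable S"
    and b: "\<And>x. x \<in> space S \<Longrightarrow> \<bar>f x\<bar> \<le> b"
  shows "completely_tendsto (\<lambda>n \<omega>. (\<Sum>l<n. f (X i l \<omega>)) / n) (\<integral>x. f x \<partial>p i)"
  unfolding completely_tendsto_def
proof (intro conjI allI impI)
  note [measurable] = X_measurable[OF i]
  show "(\<lambda>\<omega>. (\<Sum>l<n. f (X i l \<omega>)) / real n) \<in> borel_measurable M" for n by measurable
  fix e :: real assume e: "0 < e"
  \<comment> \<open>\<open>b\<close> may be 0, whereas \<open>Hoeffding_sample_sum\<close> asks for
    a positive bound.\<close>
  define b' where "b' = \<bar>b\<bar> + 1"
  have b': "0 < b'" "\<And>x. x \<in> space S \<Longrightarrow> \<bar>f x\<bar> \<le> b'" using b by (fastforce simp: b'_def)+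
  let ?r = "exp (- (e\<^sup>2 / (2 * b'\<^sup>2)))"
  have r: "0 \<le> ?r" "?r < 1" using e b' by auto
  have "\<forall>\<^sub>F n in sequentially. norm (prob {\<omega> \<in> space M. e \<le> \<bar>(\<Sum>l<n. f (X i l \<omega>)) / n - (\<integral>x. f x \<partial>p i)\<bar>}) \<le> 2 * ?r ^ n"
    using eventually_gt_at_top[of 0]
  proof eventually_elim
    case (elim n)
    have "e \<le> \<bar>(\<Sum>l<n. f (X i l \<omega>)) / n - (\<integral>x. f x \<partial>p i)\<bar> \<longleftrightarrow>
          n * e \<le> \<bar>\<Sum>l<n. f (X i l \<omega>) - (\<integral>x. f x \<partial>p i)\<bar>" for \<omega>
    proof -
      have "(\<Sum>l<n. f (X i l \<omega>)) / n - (\<integral>x. f x \<partial>p i) = (\<Sum>l<n. f (X i l \<omega>) - (\<integral>x. f x \<partial>p i)) / n"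
        using elim by (simp add: sum_subtractf field_simps)
      then show ?thesis using elim by (simp add: field_simps)
    qed
    then show ?case
      using Hoeffding_sample_sum[OF i f b'(2,1), of "{..<n}" n e] e by simp
  qed
  then show "summable (\<lambda>n. prob {\<omega> \<in> space M. e \<le> \<bar>(\<Sum>l<n. f (X i l \<omega>)) / n - (\<integral>x. f x \<partial>p i)\<bar>})"
    by (rule summable_comparison_test_ev) (use r in \<open>auto intro!: summable_mult summable_geometric\<close>)
qed

end

section \<open>Averages of a bounded kernel over pairs of samples\<close>

locale kernel_sequences = iid_sequences M S X p m
  for M :: "'w measure" and S :: "'x measure" and X p m +
  fixes k :: "'x \<Rightarrow> 'x \<Rightarrow> real" and G :: real
  assumes k_meas: "(\<lambda>(x, y). k x y) \<in> borel_measurable (S \<Otimes>\<^sub>M S)"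
    and k_pd: "pd_kernel k"
    and k_bnd: "0 \<le> k x y \<and> k x y \<le> G"
begin

lemma G_nonneg: "0 \<le> G"
  using k_bnd by (meson order_trans)

lemma measurable_k [measurable (raw)]:
  assumes [measurable]: "f \<in> measurable N S" "g \<in> measurable N S"
  shows "(\<lambda>\<omega>. k (f \<omega>) (g \<omega>)) \<in> borel_measurable N"
  using measurable_compose[OF measurable_Pair[OF assms] k_meas] by simp

definition mean_embedding :: "nat \<Rightarrow> 'x \<Rightarrow> real" where
  "mean_embedding j x = (\<integral>y. k x y \<partial>p j)"

text \<open>The expectation of \<open>k\<close> at two independent points drawn from
  \<open>p i\<close> and \<open>p j\<close>, independent also when \<open>i = j\<close>.\<close>

definition mean_kernel :: "nat \<Rightarrow> nat \<Rightarrow> real" where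
  "mean_kernel i j = (\<integral>x. mean_embedding j x \<partial>p i)"

lemma measurable_mean_embedding [measurable]:
  assumes "j < m"
  shows "mean_embedding j \<in> borel_measurable S"
proof -
  interpret P: prob_space "p j" by (rule prob_space_p) fact
  have "(\<lambda>(x, y). k x y) \<in> borel_measurable (S \<Otimes>\<^sub>M p j)"
    using k_meas by (simp add: measurable_cong_sets[OF sets_pair_measure_cong[OF refl sets_p[OF assms]] refl])
  then have "(\<lambda>x. \<integral>y. k x y \<partial>p j) \<in> borel_measurable S"
    by (rule P.borel_measurable_lebesgue_integral)
  then show ?thesis unfolding mean_embedding_def[abs_def] .
qed

lemma abs_k_le: "\<bar>k x y\<bar> \<le> G"
  using k_bnd[of x y] by simp

lemma abs_mean_embedding_le:
  assumes "j < m" "x \<in> space S"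
  shows "\<bar>mean_embedding j x\<bar> \<le> G"
  unfolding mean_embedding_def using assms abs_k_le by (intro abs_integral_p_le) auto

text \<open>Given the point \<open>X i l\<close>, the row is a sum of independent centred terms. The
  condition \<open>l \<notin> J\<close> keeps this point out of the row when \<open>i = j\<close>,
  and \<open>G + 1\<close> is a kernel bound that is positive even if \<open>G = 0\<close>.\<close>

lemma Hoeffding_row_sum:
  assumes i: "i < m" and j: "j < m" and J: "finite J" "card J \<le> n" "l \<notin> J" and e: "0 < e"
  shows "prob {\<omega> \<in> space M. n * e \<le> \<bar>\<Sum>l'\<in>J. k (X i l \<omega>) (X j l' \<omega>) - mean_embedding j (X i l \<omega>)\<bar>}
    \<le> 2 * exp (- (e\<^sup>2 / (2 * (G + 1)\<^sup>2))) ^ n"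
proof -
  \<comment> \<open>The sample family is split along the disjoint index sets \<open>A\<close> and
    \<open>B\<close>, so that \<open>prob_indep_pair_le\<close> can freeze the point with index
    \<open>(i, l)\<close>.\<close>
  define A where "A = {(i, l)}"
  define B where "B = Pair j ` J"
  define Y where "Y = (\<lambda>\<omega>. restrict (\<lambda>il. (case il of (i, l) \<Rightarrow> X i l) \<omega>) A)"
  define Z where "Z = (\<lambda>\<omega>. restrict (\<lambda>il. (case il of (i, l) \<Rightarrow> X i l) \<omega>) B)"
  define E where "E = {yz \<in> space (PiM A (\<lambda>_. S) \<Otimes>\<^sub>M PiM B (\<lambda>_. S)). n * e \<le>
     \<bar>\<Sum>l'\<in>J. k (fst yz (i, l)) (snd yz (j, l')) - mean_embedding j (fst yz (i, l))\<bar>}"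
  have ind: "indep_var (PiM A (\<lambda>_. S)) Y (PiM B (\<lambda>_. S)) Z"
    unfolding Y_def Z_def using i j J by (intro indep_var_restrict[OF indep]) (auto simp: A_def B_def)
  have meas: "Y \<in> measurable M (PiM A (\<lambda>_. S))" "Z \<in> measurable M (PiM B (\<lambda>_. S))"
    using ind unfolding indep_var_distribution_eq by auto
  note [measurable] = measurable_mean_embedding[OF j]
  have [measurable]: "(\<lambda>yz. fst yz (i, l)) \<in> measurable (PiM A (\<lambda>_. S) \<Otimes>\<^sub>M PiM B (\<lambda>_. S)) S"
    by (rule measurable_compose[OF measurable_fst measurable_component_singleton]) (simp add: A_def)
  have mB: "(\<lambda>yz. snd yz (j, l')) \<in> measurable (PiM A (\<lambda>_. S) \<Otimes>\<^sub>M PiM B (\<lambda>_. S)) S" if "l' \<in> J" for l'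
    by (rule measurable_compose[OF measurable_snd measurable_component_singleton]) (use that in \<open>auto simp: B_def\<close>)
  have E: "E \<in> sets (PiM A (\<lambda>_. S) \<Otimes>\<^sub>M PiM B (\<lambda>_. S))"
    unfolding E_def using mB by measurable
  have sp: "(y, Z \<omega>) \<in> space (PiM A (\<lambda>_. S) \<Otimes>\<^sub>M PiM B (\<lambda>_. S))"
    if "y \<in> space (PiM A (\<lambda>_. S))" "\<omega> \<in> space M" for y \<omega>
    using that measurable_space[OF meas(2)] by (simp add: space_pair_measure)
  have Zv: "Z \<omega> (j, l') = X j l' \<omega>" if "l' \<in> J" for l' \<omega>
    using that by (auto simp: Z_def B_def)
  have "prob {\<omega> \<in> space M. (Y \<omega>, Z \<omega>) \<in> E} \<le> 2 * exp (- (e\<^sup>2 / (2 * (G + 1)\<^sup>2))) ^ n"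
  proof (rule prob_indep_pair_le[OF ind E])
    fix y assume y: "y \<in> space (PiM A (\<lambda>_. S))"
    define x where "x = y (i, l)"
    have x: "x \<in> space S" using y by (auto simp: x_def A_def space_PiM)
    have "{\<omega> \<in> space M. (y, Z \<omega>) \<in> E}
        = {\<omega> \<in> space M. n * e \<le> \<bar>\<Sum>l'\<in>J. k x (X j l' \<omega>) - (\<integral>y. k x y \<partial>p j)\<bar>}"
      using sp[OF y] by (auto simp: E_def x_def[symmetric] Zv mean_embedding_def)
    then show "prob {\<omega> \<in> space M. (y, Z \<omega>) \<in> E} \<le> 2 * exp (- (e\<^sup>2 / (2 * (G + 1)\<^sup>2))) ^ n"
      using x J e G_nonneg by (simp only:) (intro Hoeffding_sample_sum[OF j]; simp add: abs_k_le add_increasing2)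
  qed
  also have "{\<omega> \<in> space M. (Y \<omega>, Z \<omega>) \<in> E} =
    {\<omega> \<in> space M. n * e \<le> \<bar>\<Sum>l'\<in>J. k (X i l \<omega>) (X j l' \<omega>) - mean_embedding j (X i l \<omega>)\<bar>}"
    using sp measurable_space[OF meas(1)] by (auto simp: E_def Zv) (auto simp: Y_def A_def)
  finally show ?thesis .
qed

text \<open>All rows of the double sum are controlled by a union bound; the diagonal terms, which
  need not have mean \<^term>\<open>mean_kernel\<close> when i = j, contribute only O(1/n).\<close>

lemma kernel_average_completely_tendsto:
  assumes i: "i < m" and j: "j < m"
  shows "completely_tendsto (\<lambda>n \<omega>. (\<Sum>l<n. \<Sum>l'<n. k (X i l \<omega>) (X j l' \<omega>)) / (real n)\<^sup>2) (mean_kernel i j)"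
  unfolding completely_tendsto_def
proof (intro conjI allI impI)
  note [measurable] = X_measurable[OF i] X_measurable[OF j] measurable_mean_embedding[OF j]
  show "(\<lambda>\<omega>. (\<Sum>l<n. \<Sum>l'<n. k (X i l \<omega>) (X j l' \<omega>)) / (real n)\<^sup>2) \<in> borel_measurable M" for n
    by measurable
  fix e :: real assume e: "0 < e"
  \<comment> \<open>The deviation \<open>e\<close> is shared equally by three sources: the
    off-diagonal parts of the rows, the diagonal terms, and the average of the mean
    embedding.\<close>
  define r where "r = exp (- ((e/3)\<^sup>2 / (2 * (G + 1)\<^sup>2)))"
  have r: "0 \<le> r" "r < 1" using e G_nonneg by (auto simp: r_def)
  let ?\<mu> = "mean_embedding j" and ?\<theta> = "mean_kernel i j"
  let ?T = "\<lambda>n \<omega>. (\<Sum>l<n. \<Sum>l'<n. k (X i l \<omega>) (X j l' \<omega>)) / (real n)\<^sup>2"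
  let ?R = "\<lambda>n l. {\<omega> \<in> space M. n * (e / 3) \<le> \<bar>\<Sum>l'\<in>{..<n} - {l}. k (X i l \<omega>) (X j l' \<omega>) - ?\<mu> (X i l \<omega>)\<bar>}"
  let ?Q = "\<lambda>n. {\<omega> \<in> space M. n * (e / 3) \<le> \<bar>\<Sum>l<n. ?\<mu> (X i l \<omega>) - ?\<theta>\<bar>}"
  \<comment> \<open>A diagonal term deviates by at most \<open>2 * G\<close>, which is eventually
    below its share of a row.\<close>
  have "\<forall>\<^sub>F n in sequentially. 2 * G < real n * (e / 3)"
    using e by real_asymp
  then have "\<forall>\<^sub>F n in sequentially. norm (prob {\<omega> \<in> space M. e \<le> \<bar>?T n \<omega> - ?\<theta>\<bar>}) \<le> 2 * ((real n + 1) * r ^ n)"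
    using eventually_gt_at_top[of 0]
  proof eventually_elim
    case (elim n)
    have sub: "{\<omega> \<in> space M. e \<le> \<bar>?T n \<omega> - ?\<theta>\<bar>} \<subseteq> (\<Union>l<n. ?R n l) \<union> ?Q n"
    proof (rule subsetI, rule ccontr)
      fix \<omega> assume \<omega>: "\<omega> \<in> {\<omega> \<in> space M. e \<le> \<bar>?T n \<omega> - ?\<theta>\<bar>}" "\<omega> \<notin> (\<Union>l<n. ?R n l) \<union> ?Q n"
      define row where "row l = (\<Sum>l'<n. k (X i l \<omega>) (X j l' \<omega>) - ?\<mu> (X i l \<omega>))" for l
      have row: "\<bar>row l\<bar> \<le> 2 * (n * (e / 3))" if "l < n" for l
      proof -
        have "X i l \<omega> \<in> space S" using \<omega> measurable_space[OF X_measurable[OF i]] by auto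
        then have "\<bar>k (X i l \<omega>) (X j l \<omega>) - ?\<mu> (X i l \<omega>)\<bar> \<le> 2 * G"
          using abs_k_le[of "X i l \<omega>" "X j l \<omega>"] abs_mean_embedding_le[OF j, of "X i l \<omega>"] by linarith
        moreover have "row l = (k (X i l \<omega>) (X j l \<omega>) - ?\<mu> (X i l \<omega>))
            + (\<Sum>l'\<in>{..<n} - {l}. k (X i l \<omega>) (X j l' \<omega>) - ?\<mu> (X i l \<omega>))"
          unfolding row_def using that by (intro sum.remove) auto
        moreover have "\<bar>\<Sum>l'\<in>{..<n} - {l}. k (X i l \<omega>) (X j l' \<omega>) - ?\<mu> (X i l \<omega>)\<bar> < n * (e / 3)"
          using \<omega> that by (auto simp: not_le)
        ultimately show ?thesis using elim(1) by linarith
      qed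
      have "\<bar>\<Sum>l<n. row l\<bar> \<le> (\<Sum>l<n. \<bar>row l\<bar>)" by (rule sum_abs)
      also have "\<dots> \<le> (\<Sum>l<n. 2 * (n * (e / 3)))" using row by (intro sum_mono) auto
      finally have 1: "\<bar>\<Sum>l<n. row l\<bar> \<le> (real n)\<^sup>2 * (2 * e / 3)" by (simp add: power2_eq_square)
      have 2: "\<bar>\<Sum>l<n. ?\<mu> (X i l \<omega>) - ?\<theta>\<bar> < n * (e / 3)" using \<omega> by (auto simp: not_le)
      \<comment> \<open>A two-stage decomposition: each row is centred at the mean embedding of its
        first point, and these means are then centred at \<open>mean_kernel i j\<close>.\<close>
      have eq: "(real n)\<^sup>2 * (?T n \<omega> - ?\<theta>) = (\<Sum>l<n. row l) + n * (\<Sum>l<n. ?\<mu> (X i l \<omega>) - ?\<theta>)"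
      proof -
        have "(\<Sum>l<n. row l) = (\<Sum>l<n. \<Sum>l'<n. k (X i l \<omega>) (X j l' \<omega>)) - n * (\<Sum>l<n. ?\<mu> (X i l \<omega>))"
          by (simp add: row_def sum_subtractf sum_distrib_left)
        moreover have "(\<Sum>l<n. ?\<mu> (X i l \<omega>) - ?\<theta>) = (\<Sum>l<n. ?\<mu> (X i l \<omega>)) - n * ?\<theta>"
          by (simp add: sum_subtractf)
        moreover have "(real n)\<^sup>2 * (?T n \<omega> - ?\<theta>) = (\<Sum>l<n. \<Sum>l'<n. k (X i l \<omega>) (X j l' \<omega>)) - n * (n * ?\<theta>)"
          using elim(2) by (simp add: right_diff_distrib power2_eq_square)
        ultimately show ?thesis by (simp add: right_diff_distrib)
      qed
      have "(real n)\<^sup>2 * \<bar>?T n \<omega> - ?\<theta>\<bar> = \<bar>(real n)\<^sup>2 * (?T n \<omega> - ?\<theta>)\<bar>" by (simp add: abs_mult)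
      also have "\<dots> \<le> \<bar>\<Sum>l<n. row l\<bar> + \<bar>n * (\<Sum>l<n. ?\<mu> (X i l \<omega>) - ?\<theta>)\<bar>"
        unfolding eq by (rule abs_triangle_ineq)
      also have "\<dots> = \<bar>\<Sum>l<n. row l\<bar> + n * \<bar>\<Sum>l<n. ?\<mu> (X i l \<omega>) - ?\<theta>\<bar>" by (simp add: abs_mult)
      also have "\<dots> < (real n)\<^sup>2 * (2 * e / 3) + n * (n * (e / 3))"
        using 1 2 elim(2) by (intro add_le_less_mono mult_strict_left_mono) auto
      also have "\<dots> = (real n)\<^sup>2 * e" by (simp add: power2_eq_square field_simps)
      finally have "\<bar>?T n \<omega> - ?\<theta>\<bar> < e" using elim(2) by simp
      with \<omega> show False by auto
    qed
    have "prob {\<omega> \<in> space M. e \<le> \<bar>?T n \<omega> - ?\<theta>\<bar>} \<le> prob ((\<Union>l<n. ?R n l) \<union> ?Q n)"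
      by (rule finite_measure_mono[OF sub]) measurable
    also have "\<dots> \<le> prob (\<Union>l<n. ?R n l) + prob (?Q n)" by (rule measure_Un_le) measurable
    also have "\<dots> \<le> (\<Sum>l<n. prob (?R n l)) + prob (?Q n)"
      by (intro add_right_mono finite_measure_subadditive_finite) auto
    also have "\<dots> \<le> (\<Sum>l<n. 2 * r ^ n) + 2 * r ^ n"
    proof (intro add_mono sum_mono)
      show "prob (?R n l) \<le> 2 * r ^ n" for l
        unfolding r_def using e by (intro Hoeffding_row_sum[OF i j]) (auto intro: card_Diff1_le[THEN order_trans])
      show "prob (?Q n) \<le> 2 * r ^ n"
        unfolding r_def mean_kernel_def using e abs_mean_embedding_le[OF j] G_nonneg
        by (intro Hoeffding_sample_sum[OF i]) (auto intro: order_trans[where y = G])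
    qed
    finally show ?case by (simp add: algebra_simps)
  qed
  then show "summable (\<lambda>n. prob {\<omega> \<in> space M. e \<le> \<bar>?T n \<omega> - ?\<theta>\<bar>})"
    by (rule summable_comparison_test_ev) (intro summable_mult summable_poly_geometric r)
qed

subsection \<open>The estimated distances and the maximum mean discrepancy\<close>

text \<open>The RKHS distance between the two population mean embeddings, with its square expanded
  into inner products.\<close>

definition kernel_distance :: "nat \<Rightarrow> nat \<Rightarrow> real" where
  "kernel_distance i j = sqrt (mean_kernel i i + mean_kernel j j - 2 * mean_kernel i j)"

lemma dhat_eq_kernel_averages:
  "dhat k X n \<omega> i j = sqrt ((\<Sum>l<n. \<Sum>l'<n. k (X i l \<omega>) (X i l' \<omega>)) / (real n)\<^sup>2
     + (\<Sum>l<n. \<Sum>l'<n. k (X j l \<omega>) (X j l' \<omega>)) / (real n)\<^sup>2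
     - 2 * ((\<Sum>l<n. \<Sum>l'<n. k (X i l \<omega>) (X j l' \<omega>)) / (real n)\<^sup>2))"
  unfolding dhat_def
  by (simp add: sum_subtractf sum.distrib sum_distrib_left[symmetric] diff_divide_distrib add_divide_distrib)

lemma dhat_nonneg: "0 \<le> dhat k X n \<omega> i j"
  unfolding dhat_eq_norm_emp_diff[OF k_pd] using kcomb_norm2_nonneg[OF k_pd] by simp

lemma dhat_le: "dhat k X n \<omega> i j \<le> sqrt (2 * G)"
proof (cases "n = 0")
  case True
  then show ?thesis using G_nonneg by (simp add: dhat_def)
next
  case False
  have "k (X i l \<omega>) (X i l' \<omega>) + k (X j l \<omega>) (X j l' \<omega>) - 2 * k (X i l \<omega>) (X j l' \<omega>) \<le> 2 * G" for l l'
    using k_bnd[of "X i l \<omega>" "X i l' \<omega>"] k_bnd[of "X j l \<omega>" "X j l' \<omega>"] k_bnd[of "X i l \<omega>" "X j l' \<omega>"]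
    by linarith
  then have "(\<Sum>l<n. \<Sum>l'<n. k (X i l \<omega>) (X i l' \<omega>) + k (X j l \<omega>) (X j l' \<omega>) - 2 * k (X i l \<omega>) (X j l' \<omega>))
      \<le> (\<Sum>l<n. \<Sum>l'<n. 2 * G)"
    by (intro sum_mono)
  also have "\<dots> = (real n)\<^sup>2 * (2 * G)" by (simp add: power2_eq_square)
  finally show ?thesis
    unfolding dhat_def using False by (intro real_sqrt_le_mono) (simp add: field_simps)
qed

lemma dhat_completely_tendsto:
  assumes i: "i < m" and j: "j < m"
  shows "completely_tendsto (\<lambda>n \<omega>. dhat k X n \<omega> i j) (kernel_distance i j)"
proof (rule completely_tendsto_transfer)
  let ?T = "\<lambda>(i, j) n \<omega>. (\<Sum>l<n. \<Sum>l'<n. k (X i l \<omega>) (X j l' \<omega>)) / (real n)\<^sup>2"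
  let ?\<theta> = "\<lambda>(i, j). mean_kernel i j"
  let ?I = "{(i, i), (j, j), (i, j)}"
  show "finite ?I" by simp
  show "completely_tendsto (?T a) (?\<theta> a)" if "a \<in> ?I" for a
    using that kernel_average_completely_tendsto i j by auto
  note [measurable] = X_measurable[OF i] X_measurable[OF j]
  show "(\<lambda>\<omega>. dhat k X n \<omega> i j) \<in> borel_measurable M" for n
    unfolding dhat_def by measurable
  fix e :: real assume "0 < e"
  \<comment> \<open>Continuity at 0 is included, so equal distributions need no separate
    treatment.\<close>
  moreover have "isCont sqrt (mean_kernel i i + mean_kernel j j - 2 * mean_kernel i j)"
    by (rule isCont_real_sqrt)
  ultimately obtain d where d: "0 < d" and close: "\<And>x. \<bar>x - (mean_kernel i i + mean_kernel j j - 2 * mean_kernel i j)\<bar> < d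
      \<Longrightarrow> \<bar>sqrt x - kernel_distance i j\<bar> < e"
    unfolding continuous_at_eps_delta kernel_distance_def dist_real_def by blast
  \<comment> \<open>The coefficients 1, 1 and 2 add up to 4, hence the tolerance
    \<open>d / 4\<close>.\<close>
  have lin: "\<bar>a + b - 2 * c - (a' + b' - 2 * c')\<bar> < d"
    if "\<bar>a - a'\<bar> < d / 4" "\<bar>b - b'\<bar> < d / 4" "\<bar>c - c'\<bar> < d / 4" for a b c a' b' c' :: real
    using that by linarith
  show "\<exists>d>0. \<forall>\<^sub>F n in sequentially. \<forall>\<omega>\<in>space M.
    (\<forall>a\<in>?I. \<bar>?T a n \<omega> - ?\<theta> a\<bar> < d) \<longrightarrow> \<bar>dhat k X n \<omega> i j - kernel_distance i j\<bar> < e"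
  proof (intro exI conjI always_eventually allI ballI impI)
    show "0 < d / 4" using d by simp
    fix n \<omega> assume "\<forall>a\<in>?I. \<bar>?T a n \<omega> - ?\<theta> a\<bar> < d / 4"
    then show "\<bar>dhat k X n \<omega> i j - kernel_distance i j\<bar> < e"
      unfolding dhat_eq_kernel_averages by (intro close lin) auto
  qed
qed

text \<open>\<open>sqrt\<close> is negative on negative arguments, so the sign is not automatic; it
  is inherited from the estimates along one path.\<close>

lemma kernel_distance_nonneg:
  assumes "i < m" "j < m"
  shows "0 \<le> kernel_distance i j"
proof -
  obtain \<omega> where "(\<lambda>n. dhat k X n \<omega> i j) \<longlonglongrightarrow> kernel_distance i j"
    using AE_witness[OF completely_tendsto_AE[OF dhat_completely_tendsto[OF assms]]] by blast
  then show ?thesis by (rule LIMSEQ_le_const) (auto intro: dhat_nonneg)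
qed

text \<open>By symmetry of the kernel, both sides are limits of the same averages on a common
  path.\<close>

lemma mean_kernel_commute:
  assumes i: "i < m" and j: "j < m"
  shows "mean_kernel i j = mean_kernel j i"
proof -
  let ?T = "\<lambda>i j n \<omega>. (\<Sum>l<n. \<Sum>l'<n. k (X i l \<omega>) (X j l' \<omega>)) / (real n)\<^sup>2"
  have "AE \<omega> in M. (\<lambda>n. ?T i j n \<omega>) \<longlonglongrightarrow> mean_kernel i j \<and> (\<lambda>n. ?T j i n \<omega>) \<longlonglongrightarrow> mean_kernel j i"
    using completely_tendsto_AE[OF kernel_average_completely_tendsto[OF i j]]
      completely_tendsto_AE[OF kernel_average_completely_tendsto[OF j i]] by (rule AE_conjI)
  then obtain \<omega> where lim: "(\<lambda>n. ?T i j n \<omega>) \<longlonglongrightarrow> mean_kernel i j" "(\<lambda>n. ?T j i n \<omega>) \<longlonglongrightarrow> mean_kernel j i"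
    by (rule AE_witness) auto
  have "?T i j n \<omega> = ?T j i n \<omega>" for n
    by (subst sum.swap) (simp add: pd_kernel_commute[OF k_pd, of "X i _ _"])
  with lim show ?thesis by (simp add: LIMSEQ_unique)
qed

text \<open>The pairing with the empirical measures is bounded pathwise, so that only f has to be
  measurable: it may be a limit of non-measurable kernel combinations with centres outside
  \<^term>\<open>space S\<close>. If f itself is not measurable, both integrals have the junk value 0.\<close>

lemma rkhs_unit_ball_mean_diff_le:
  assumes i: "i < m" and j: "j < m" and f: "f \<in> rkhs_unit_ball k"
  shows "(\<integral>x. f x \<partial>p i) - (\<integral>x. f x \<partial>p j) \<le> kernel_distance i j"
proof (cases "f \<in> borel_measurable S")
  case True
  have b: "\<bar>f x\<bar> \<le> sqrt G" for x
    using rkhs_unit_ball_abs_le[OF k_pd f, of x] k_bnd[of x x] real_sqrt_le_mono order_trans by blast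
  have "AE \<omega> in M. (\<lambda>n. dhat k X n \<omega> i j) \<longlonglongrightarrow> kernel_distance i j \<and>
      (\<lambda>n. (\<Sum>l<n. f (X i l \<omega>)) / n) \<longlonglongrightarrow> (\<integral>x. f x \<partial>p i) \<and>
      (\<lambda>n. (\<Sum>l<n. f (X j l \<omega>)) / n) \<longlonglongrightarrow> (\<integral>x. f x \<partial>p j)"
    using True b i j
    by (intro AE_conjI completely_tendsto_AE dhat_completely_tendsto sample_mean_completely_tendsto)
  then obtain \<omega> where lim: "(\<lambda>n. dhat k X n \<omega> i j) \<longlonglongrightarrow> kernel_distance i j"
      "(\<lambda>n. (\<Sum>l<n. f (X i l \<omega>)) / n) \<longlonglongrightarrow> (\<integral>x. f x \<partial>p i)"
      "(\<lambda>n. (\<Sum>l<n. f (X j l \<omega>)) / n) \<longlonglongrightarrow> (\<integral>x. f x \<partial>p j)"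
    by (rule AE_witness) auto
  have "(\<Sum>l<n. f (X i l \<omega>)) / n - (\<Sum>l<n. f (X j l \<omega>)) / n \<le> dhat k X n \<omega> i j" for n
    using rkhs_unit_ball_pairing_le[OF k_pd f, of "emp_diff n (\<lambda>l. X i l \<omega>) (\<lambda>l. X j l \<omega>)"]
    unfolding dhat_eq_norm_emp_diff[OF k_pd] emp_diff_pairing by linarith
  then show ?thesis
    by (intro LIMSEQ_le[OF tendsto_diff[OF lim(2,3)] lim(1)]) auto
next
  case False
  then have "\<not> integrable (p a) f" if "a < m" for a
    using that by (auto dest!: borel_measurable_integrable simp: measurable_cong_sets[OF sets_p refl])
  then show ?thesis
    using kernel_distance_nonneg[OF i j] i j by (simp add: not_integrable_integral_eq)
qed

lemma integral_kcomb_eval_emp_diff: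
  assumes a: "a < m" and "\<And>l. x l \<in> space S" "\<And>l. y l \<in> space S"
  shows "(\<integral>z. kcomb_eval k (emp_diff n x y) z \<partial>p a)
    = (\<Sum>l<n. mean_embedding a (x l)) / n - (\<Sum>l<n. mean_embedding a (y l)) / n"
proof -
  have int: "integrable (p a) (k z)" if "z \<in> space S" for z
    using that abs_k_le by (intro integrable_p[OF a]) auto
  then show ?thesis
    unfolding kcomb_eval_emp_diff mean_embedding_def using assms(2,3)
    by (subst Bochner_Integration.integral_diff) (auto intro!: Bochner_Integration.integrable_sum)
qed

text \<open>The upper bound is \<open>rkhs_unit_ball_mean_diff_le\<close>. For the lower bound the
  test function is the empirical difference \<open>h\<close> divided by its norm \<open>r\<close>:
  its mean difference tends to the squared distance over the distance. The population embeddings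
  thus never have to be exhibited as members of the RKHS.\<close>

lemma mmd_eq_kernel_distance:
  assumes i: "i < m" and j: "j < m"
  shows "mmd k (p i) (p j) = kernel_distance i j"
proof -
  let ?F = "{(\<integral>x. f x \<partial>p i) - (\<integral>x. f x \<partial>p j) | f. f \<in> rkhs_unit_ball k}"
  have bdd: "bdd_above ?F"
    using rkhs_unit_ball_mean_diff_le[OF i j] by (auto intro!: bdd_aboveI[of _ "kernel_distance i j"])
  have ge: "(\<integral>x. kcomb_eval k g x \<partial>p i) - (\<integral>x. kcomb_eval k g x \<partial>p j) \<le> mmd k (p i) (p j)"
    if "kcomb_norm2 k g \<le> 1" for g
    unfolding mmd_def using kcomb_eval_in_rkhs_unit_ball[OF k_pd that]
    by (intro cSup_upper bdd) auto
  have "mmd k (p i) (p j) \<le> kernel_distance i j"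
    unfolding mmd_def using rkhs_unit_ball_mean_diff_le[OF i j]
      kcomb_eval_in_rkhs_unit_ball[OF k_pd, of "[]"]
    by (intro cSup_least) (auto simp: kcomb_norm2_def)
  moreover have "kernel_distance i j \<le> mmd k (p i) (p j)"
  proof (cases "kernel_distance i j = 0")
    case True
    then show ?thesis using ge[of "[]"] by (simp add: kcomb_norm2_def)
  next
    case False
    then have pos: "0 < kernel_distance i j" using kernel_distance_nonneg[OF i j] by simp
    let ?avg = "\<lambda>a b \<omega> n. (\<Sum>l<n. mean_embedding b (X a l \<omega>)) / n"
    have avg: "AE \<omega> in M. ?avg a b \<omega> \<longlonglongrightarrow> mean_kernel a b" if "a < m" "b < m" for a b
      using completely_tendsto_AE[OF sample_mean_completely_tendsto[OF that(1) measurable_mean_embedding[OF that(2)]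
          abs_mean_embedding_le[OF that(2)]]] by (simp add: mean_kernel_def)
    have "AE \<omega> in M. (\<lambda>n. dhat k X n \<omega> i j) \<longlonglongrightarrow> kernel_distance i j \<and>
       ?avg i i \<omega> \<longlonglongrightarrow> mean_kernel i i \<and> ?avg j i \<omega> \<longlonglongrightarrow> mean_kernel j i \<and>
       ?avg i j \<omega> \<longlonglongrightarrow> mean_kernel i j \<and> ?avg j j \<omega> \<longlonglongrightarrow> mean_kernel j j"
      using i j by (intro AE_conjI avg completely_tendsto_AE[OF dhat_completely_tendsto])
    then obtain \<omega> where \<omega>: "\<omega> \<in> space M" and lim: "(\<lambda>n. dhat k X n \<omega> i j) \<longlonglongrightarrow> kernel_distance i j"
       "?avg i i \<omega> \<longlonglongrightarrow> mean_kernel i i" "?avg j i \<omega> \<longlonglongrightarrow> mean_kernel j i"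
       "?avg i j \<omega> \<longlonglongrightarrow> mean_kernel i j" "?avg j j \<omega> \<longlonglongrightarrow> mean_kernel j j"
      by (rule AE_witness) auto
    have sp: "X a l \<omega> \<in> space S" if "a < m" for a l
      using measurable_space[OF X_measurable[OF that] \<omega>] .
    have "eventually (\<lambda>n. 0 < dhat k X n \<omega> i j) sequentially"
      using lim(1) pos by (rule order_tendstoD)
    then have "eventually (\<lambda>n. (?avg i i \<omega> n - ?avg j i \<omega> n) - (?avg i j \<omega> n - ?avg j j \<omega> n)
        \<le> mmd k (p i) (p j) * dhat k X n \<omega> i j) sequentially"
    proof eventually_elim
      case (elim n)
      define h where "h = emp_diff n (\<lambda>l. X i l \<omega>) (\<lambda>l. X j l \<omega>)"
      define r where "r = dhat k X n \<omega> i j"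
      have "r\<^sup>2 = kcomb_norm2 k h"
        unfolding r_def h_def dhat_eq_norm_emp_diff[OF k_pd] using kcomb_norm2_nonneg[OF k_pd] by simp
      then have "kcomb_norm2 k (kcomb_scale (1 / r) h) \<le> 1"
        by (simp add: kcomb_norm2_scale power_divide)
      from ge[OF this] have "((\<integral>x. kcomb_eval k h x \<partial>p i) - (\<integral>x. kcomb_eval k h x \<partial>p j)) / r \<le> mmd k (p i) (p j)"
        by (simp add: diff_divide_distrib)
      then have "(\<integral>x. kcomb_eval k h x \<partial>p i) - (\<integral>x. kcomb_eval k h x \<partial>p j) \<le> mmd k (p i) (p j) * r"
        using elim by (simp add: r_def field_simps)
      then show ?case
        unfolding h_def r_def using integral_kcomb_eval_emp_diff[of _ "\<lambda>l. X i l \<omega>" "\<lambda>l. X j l \<omega>"] i j sp by simp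
    qed
    \<comment> \<open>In the limit the left side is the square of
      \<open>kernel_distance i j\<close>, by symmetry of \<open>mean_kernel\<close>.\<close>
    then have "(mean_kernel i i - mean_kernel j i) - (mean_kernel i j - mean_kernel j j)
        \<le> mmd k (p i) (p j) * kernel_distance i j"
      by (rule tendsto_le[OF sequentially_bot tendsto_mult_left[OF lim(1)]
          tendsto_diff[OF tendsto_diff[OF lim(2,3)] tendsto_diff[OF lim(4,5)]]])
    moreover have "(kernel_distance i j)\<^sup>2 = mean_kernel i i + mean_kernel j j - 2 * mean_kernel i j"
      using pos unfolding kernel_distance_def by simp
    ultimately have "kernel_distance i j * kernel_distance i j \<le> mmd k (p i) (p j) * kernel_distance i j"
      using mean_kernel_commute[OF i j] by (simp add: power2_eq_square)
    then show ?thesis using pos by (rule mult_right_le_imp_le)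
  qed
  ultimately show ?thesis by simp
qed

end

subsection \<open>Single linkage\<close>

lemma linkage_le:
  assumes "finite A" "finite B" "i \<in> A" "j \<in> B"
  shows "linkage \<delta> A B \<le> \<delta> i j"
proof -
  have "{\<delta> i j | i j. i \<in> A \<and> j \<in> B} = (\<lambda>(i, j). \<delta> i j) ` (A \<times> B)" by auto
  then show ?thesis unfolding linkage_def using assms by (intro Min_le) auto
qed

lemma linkage_attained:
  assumes "finite A" "finite B" "A \<noteq> {}" "B \<noteq> {}"
  obtains i j where "i \<in> A" "j \<in> B" "linkage \<delta> A B = \<delta> i j"
proof -
  have "{\<delta> i j | i j. i \<in> A \<and> j \<in> B} = (\<lambda>(i, j). \<delta> i j) ` (A \<times> B)" by auto
  then have "linkage \<delta> A B \<in> (\<lambda>(i, j). \<delta> i j) ` (A \<times> B)"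
    unfolding linkage_def using assms by (simp only:) (intro Min_in; auto)
  then show ?thesis using that by auto
qed

lemma partition_on_finite_block:
  "partition_on {..<m::nat} Q \<Longrightarrow> A \<in> Q \<Longrightarrow> finite A \<and> A \<noteq> {} \<and> A \<subseteq> {..<m}"
  by (auto simp: partition_on_def intro: finite_subset[of _ "{..<m}"])

lemma finite_slink_linkages:
  assumes "finite Q"
  shows "finite {linkage \<delta> A B | A B. A \<in> Q \<and> B \<in> Q \<and> A \<noteq> B}"
  by (rule finite_subset[of _ "(\<lambda>(A, B). linkage \<delta> A B) ` (Q \<times> Q)"]) (use assms in auto)

lemma slink_gap_le:
  assumes Q: "partition_on {..<m} Q" and "A \<in> Q" "B \<in> Q" "A \<noteq> B" "i \<in> A" "j \<in> B"
  shows "slink_gap \<delta> Q \<le> \<delta> i j"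
proof -
  have "finite Q" using Q by (rule finite_elements[rotated]) simp
  then have "slink_gap \<delta> Q \<le> linkage \<delta> A B"
    unfolding slink_gap_def using assms by (intro Min_le finite_slink_linkages) auto
  also have "\<dots> \<le> \<delta> i j"
    using assms partition_on_finite_block[OF Q] by (intro linkage_le) auto
  finally show ?thesis .
qed

lemma slink_gap_attained:
  assumes Q: "partition_on {..<m} Q" and "2 \<le> card Q"
  obtains A B i j where "A \<in> Q" "B \<in> Q" "A \<noteq> B" "i \<in> A" "j \<in> B" "slink_gap \<delta> Q = \<delta> i j"
proof -
  have "finite Q" using Q by (rule finite_elements[rotated]) simp
  obtain A B where "A \<in> Q" "B \<in> Q" "A \<noteq> B"
    using \<open>2 \<le> card Q\<close> by (metis card_le_Suc0_iff_eq \<open>finite Q\<close> not_less_eq_eq numeral_2_eq_2)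
  then have "slink_gap \<delta> Q \<in> {linkage \<delta> A B | A B. A \<in> Q \<and> B \<in> Q \<and> A \<noteq> B}"
    unfolding slink_gap_def using \<open>finite Q\<close> by (intro Min_in finite_slink_linkages) auto
  then obtain A B where AB: "A \<in> Q" "B \<in> Q" "A \<noteq> B" "slink_gap \<delta> Q = linkage \<delta> A B" by auto
  obtain i j where "i \<in> A" "j \<in> B" "linkage \<delta> A B = \<delta> i j"
    using AB partition_on_finite_block[OF Q] by (elim linkage_attained[rotated 4]) auto
  with AB that show ?thesis by simp
qed

text \<open>The separation of the true clusters is the gap of the true partition, so the same lemmas
  serve both.\<close>

lemma d_H_eq_slink_gap: "d_H \<delta> P = slink_gap \<delta> P"
  by (simp add: d_H_def slink_gap_def)

text \<open>A pair attaining the gap for \<open>d\<close> is a competitor for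
  \<open>\<delta>\<close>. The one-sided form can be reused with the roles exchanged.\<close>

lemma slink_gap_perturb_le:
  assumes Q: "partition_on {..<m} Q" "2 \<le> card Q"
    and "\<And>i j. i < m \<Longrightarrow> j < m \<Longrightarrow> \<delta> i j \<le> d i j + e"
  shows "slink_gap \<delta> Q \<le> slink_gap d Q + e"
proof -
  obtain A B i j where *: "A \<in> Q" "B \<in> Q" "A \<noteq> B" "i \<in> A" "j \<in> B" "slink_gap d Q = d i j"
    by (rule slink_gap_attained[OF Q])
  then have "i < m" "j < m" using partition_on_finite_block[OF Q(1)] by auto
  with assms(3) slink_gap_le[OF Q(1) *(1-5), of \<delta>] * show ?thesis by fastforce
qed

lemma slink_gap_perturb:
  assumes Q: "partition_on {..<m} Q" "2 \<le> card Q"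
    and e: "\<And>i j. i < m \<Longrightarrow> j < m \<Longrightarrow> \<bar>\<delta> i j - d i j\<bar> \<le> e"
  shows "\<bar>slink_gap \<delta> Q - slink_gap d Q\<bar> \<le> e"
proof -
  have "slink_gap \<delta> Q \<le> slink_gap d Q + e"
    by (rule slink_gap_perturb_le[OF Q]) (use e abs_le_D1 in fastforce)
  moreover have "slink_gap d Q \<le> slink_gap \<delta> Q + e"
    by (rule slink_gap_perturb_le[OF Q]) (use e abs_le_D2 in fastforce)
  ultimately show ?thesis by linarith
qed

section \<open>Merging steps and recovery of the true clusters\<close>

lemma slink_step_partition:
  assumes Q: "partition_on {..<m} Q" and "slink_step \<delta> Q Q'"
  shows "partition_on {..<m} Q'" "card Q = Suc (card Q')"
proof -
  have "finite Q" using Q by (rule finite_elements[rotated]) simp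
  from assms obtain A B where AB: "A \<in> Q" "B \<in> Q" "A \<noteq> B" and Q': "Q' = insert (A \<union> B) (Q - {A, B})"
    unfolding slink_step_def by blast
  from Q have U: "\<Union>Q = {..<m}" and d: "\<And>A B. A \<in> Q \<Longrightarrow> B \<in> Q \<Longrightarrow> A \<noteq> B \<Longrightarrow> A \<inter> B = {}"
    and ne: "{} \<notin> Q" by (auto simp: partition_on_def disjoint_def)
  show "partition_on {..<m} Q'"
    unfolding partition_on_def
  proof (intro conjI)
    show "\<Union>Q' = {..<m}" using AB U unfolding Q' by blast
    show "{} \<notin> Q'" using AB ne unfolding Q' by auto
    have "C \<inter> (A \<union> B) = {}" if "C \<in> Q - {A, B}" for C
      using d[of C A] d[of C B] AB that by blast
    then show "disjoint Q'"
      unfolding Q' disjoint_def using d by (auto 4 3)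
  qed
  \<comment> \<open>As an old block other than \<open>A\<close>, the union would be disjoint from
    \<open>A\<close>. Hence the number of blocks drops by exactly one.\<close>
  have "A \<union> B \<notin> Q - {A, B}"
    using d[of "A \<union> B" A] AB ne by auto
  moreover have "card (Q - {A, B}) = card Q - 2" "2 \<le> card Q"
    using AB \<open>finite Q\<close> card_mono[of Q "{A, B}"] by (auto simp: card_Diff_subset)
  ultimately show "card Q = Suc (card Q')"
    unfolding Q' using \<open>finite Q\<close> by simp
qed

lemma slink_output_partition:
  assumes "slink_output \<delta> m K Q"
  shows "partition_on {..<m} Q" "card Q = K"
proof -
  have "(slink_step \<delta>)\<^sup>*\<^sup>* ((\<lambda>i. {i}) ` {..<m}) Q" "card Q = K"
    using assms by (auto simp: slink_output_def)
  then show "card Q = K" by simp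
  from \<open>(slink_step \<delta>)\<^sup>*\<^sup>* _ Q\<close> show "partition_on {..<m} Q"
  proof induction
    case base
    show ?case by (auto simp: partition_on_def disjoint_def)
  next
    case (step Q Q')
    then show ?case by (blast intro: slink_step_partition)
  qed
qed

text \<open>A proper split excludes the singleton branch of \<open>d_I_cluster\<close>, and the
  maximum dominates the linkage of this split. The lemma supplies a short link across any cut of a
  true cluster.\<close>

lemma d_I_cluster_split:
  assumes "finite A" "A1 \<noteq> {}" "A2 \<noteq> {}" "A1 \<inter> A2 = {}" "A1 \<union> A2 = A"
  obtains i j where "i \<in> A1" "j \<in> A2" "\<delta> i j \<le> d_I_cluster \<delta> A"
proof -
  let ?L = "{linkage \<delta> A1 A2 | A1 A2. A1 \<noteq> {} \<and> A2 \<noteq> {} \<and> A1 \<inter> A2 = {} \<and> A1 \<union> A2 = A}"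
  have fin: "finite A1" "finite A2" using assms by auto
  obtain i j where ij: "i \<in> A1" "j \<in> A2" "linkage \<delta> A1 A2 = \<delta> i j"
    using linkage_attained[OF fin assms(2,3)] by metis
  have "card A1 \<ge> 1" "card A2 \<ge> 1" using fin assms by (auto simp: Suc_le_eq card_gt_0_iff)
  then have "card A \<noteq> 1" using card_Un_disjoint[OF fin assms(4)] unfolding assms(5) by linarith
  moreover have "finite ?L"
    by (rule finite_subset[of _ "(\<lambda>(A, B). linkage \<delta> A B) ` (Pow A \<times> Pow A)"])
       (use assms(1) in auto)
  then have "linkage \<delta> A1 A2 \<le> Max ?L" using assms by (intro Max_ge) auto
  ultimately have "\<delta> i j \<le> d_I_cluster \<delta> A" using ij(3) by (simp add: d_I_cluster_def)
  with ij(1,2) show ?thesis by (rule that)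
qed

text \<open>With more current than true clusters some true cluster is cut, and a link of true length
  at most \<open>d_I\<close> crosses the cut. The chosen merge therefore has estimated length at
  most \<open>d_I + e\<close>, which is less than \<open>d_H - e\<close>, so it cannot join points
  of different true clusters.\<close>

lemma slink_step_refines:
  assumes P: "partition_on {..<m} P" and Q: "partition_on {..<m} Q"
    and ref: "\<And>B. B \<in> Q \<Longrightarrow> \<exists>A\<in>P. B \<subseteq> A" and card: "card P < card Q"
    and e: "\<And>i j. i < m \<Longrightarrow> j < m \<Longrightarrow> \<bar>\<delta> i j - d i j\<bar> \<le> e"
    and sep: "d_I d P + 2 * e < d_H d P"
    and step: "slink_step \<delta> Q Q'" and "B \<in> Q'"
  shows "\<exists>A\<in>P. B \<subseteq> A"
proof -
  have finP: "finite P" using P by (rule finite_elements[rotated]) simp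
  note blP = partition_on_finite_block[OF P] and blQ = partition_on_finite_block[OF Q]
  from ref obtain r where r: "\<And>B. B \<in> Q \<Longrightarrow> r B \<in> P \<and> B \<subseteq> r B" by metis
  \<comment> \<open>Pigeonhole: two current clusters lie in the same true cluster.\<close>
  have "card (r ` Q) \<le> card P" using r finP by (intro card_mono) auto
  then have "\<not> inj_on r Q" using card by (auto dest: card_image)
  then obtain B1 B2 where B12: "B1 \<in> Q" "B2 \<in> Q" "B1 \<noteq> B2" "r B1 = r B2"
    by (auto simp: inj_on_def)
  define A where "A = r B1"
  have A: "A \<in> P" "B1 \<subseteq> A" "B2 \<subseteq> A" using B12 r unfolding A_def by metis+
  have "B1 \<inter> B2 = {}" using B12 Q by (auto simp: partition_on_def disjoint_def)
  then have "finite A" "B1 \<noteq> {}" "A - B1 \<noteq> {}" "B1 \<inter> (A - B1) = {}" "B1 \<union> (A - B1) = A"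
    using A blP[OF A(1)] blQ[OF B12(1)] blQ[OF B12(2)] by auto
  then obtain i j where ij: "i \<in> B1" "j \<in> A - B1" "d i j \<le> d_I_cluster d A"
    by (rule d_I_cluster_split)
  have "d_I_cluster d A \<le> d_I d P"
    unfolding d_I_def using A finP by (intro Max_ge) auto
  with ij have dij: "d i j \<le> d_I d P" by simp
  have "i < m" "j < m" using ij A blP[OF A(1)] by auto
  \<comment> \<open>The current cluster of \<open>j\<close> differs from \<open>B1\<close>, so the
    short link joins two clusters available for merging.\<close>
  then obtain B' where B': "B' \<in> Q" "j \<in> B'" using Q by (auto simp: partition_on_def)
  have "B1 \<noteq> B'" using ij B' by auto
  have *: "linkage \<delta> B1 B' \<le> d_I d P + e"
    using linkage_le[of B1 B' i j \<delta>] blQ B12 B' ij(1) dij e[OF \<open>i < m\<close> \<open>j < m\<close>] by fastforce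
  from step obtain C D where CD: "C \<in> Q" "D \<in> Q" "C \<noteq> D"
    and min: "\<And>A' B'. A' \<in> Q \<Longrightarrow> B' \<in> Q \<Longrightarrow> A' \<noteq> B' \<Longrightarrow> linkage \<delta> C D \<le> linkage \<delta> A' B'"
    and Q': "Q' = insert (C \<union> D) (Q - {C, D})"
    unfolding slink_step_def by blast
  have CDle: "linkage \<delta> C D \<le> d_I d P + e"
    using min[OF B12(1) B'(1) \<open>B1 \<noteq> B'\<close>] * by linarith
  have "r C = r D"
  proof (rule ccontr)
    assume "r C \<noteq> r D"
    obtain a b where ab: "a \<in> C" "b \<in> D" "linkage \<delta> C D = \<delta> a b"
      using linkage_attained[of C D] CD blQ by metis
    then have "d_H d P \<le> d a b"
      unfolding d_H_eq_slink_gap using r CD \<open>r C \<noteq> r D\<close>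
      by (intro slink_gap_le[OF P, of "r C" "r D"]) auto
    moreover have "a < m" "b < m" using ab CD blQ by auto
    then have "\<bar>\<delta> a b - d a b\<bar> \<le> e" by (rule e)
    ultimately show False using CDle ab sep by linarith
  qed
  then have "C \<union> D \<subseteq> r C" "r C \<in> P" using r[OF CD(1)] r[OF CD(2)] by auto
  then show ?thesis using \<open>B \<in> Q'\<close> ref unfolding Q' by auto
qed

text \<open>Sending a block of \<open>Q\<close> to the block of \<open>P\<close> containing it is
  surjective by covering, hence injective by cardinality. A point of \<open>r B\<close> outside
  \<open>B\<close> would lie in a second block with the same image.\<close>

lemma refining_partition_card_eq:
  assumes P: "partition_on S P" and Q: "partition_on S Q" and "finite S"
    and ref: "\<And>B. B \<in> Q \<Longrightarrow> \<exists>A\<in>P. B \<subseteq> A" and card: "card P = card Q"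
  shows "Q = P"
proof -
  have finP: "finite P" and finQ: "finite Q"
    using P Q \<open>finite S\<close> by (auto intro: finite_elements)
  from ref obtain r where r: "\<And>B. B \<in> Q \<Longrightarrow> r B \<in> P \<and> B \<subseteq> r B" by metis
  have "P \<subseteq> r ` Q"
  proof
    fix A assume A: "A \<in> P"
    then obtain x where x: "x \<in> A" "x \<in> S"
      using P unfolding partition_on_def by (metis UnionI ex_in_conv)
    then obtain B where B: "B \<in> Q" "x \<in> B" using Q by (auto simp: partition_on_def)
    have "r B \<inter> A \<noteq> {}" using r[OF B(1)] x B by auto
    then have "r B = A" using r[OF B(1)] A P unfolding partition_on_def disjoint_def by blast
    with B show "A \<in> r ` Q" by auto
  qed
  then have rQ: "r ` Q = P" using r by auto
  then have inj: "inj_on r Q" using card finQ by (simp add: eq_card_imp_inj_on)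
  have "r B = B" if B: "B \<in> Q" for B
  proof
    show "B \<subseteq> r B" using r B by auto
    show "r B \<subseteq> B"
    proof
      fix x assume x: "x \<in> r B"
      then have "x \<in> S" using r[OF B] P by (auto simp: partition_on_def)
      then obtain B' where B': "B' \<in> Q" "x \<in> B'" using Q by (auto simp: partition_on_def)
      then have "r B' \<inter> r B \<noteq> {}" using r[OF B'(1)] x by auto
      then have "r B' = r B" using r[OF B'(1)] r[OF B] P unfolding partition_on_def disjoint_def by blast
      then show "x \<in> B" using inj B B' by (auto simp: inj_on_def)
    qed
  qed
  with rQ show ?thesis by simp
qed

lemma slink_output_eq:
  assumes P: "partition_on {..<m} P" and out: "slink_output \<delta> m (card P) Q"
    and e: "\<And>i j. i < m \<Longrightarrow> j < m \<Longrightarrow> \<bar>\<delta> i j - d i j\<bar> \<le> e"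
    and sep: "d_I d P + 2 * e < d_H d P"
  shows "Q = P"
proof -
  have "(slink_step \<delta>)\<^sup>*\<^sup>* ((\<lambda>i. {i}) ` {..<m}) Q" and card: "card Q = card P"
    using out by (auto simp: slink_output_def)
  \<comment> \<open>Refinement is claimed only while \<open>card P \<le> card Q\<close>. A step
    ending in such a partition starts from strictly more than \<open>card P\<close> blocks, as
    \<open>slink_step_refines\<close> demands.\<close>
  from this(1) have "partition_on {..<m} Q \<and> (card P \<le> card Q \<longrightarrow> (\<forall>B\<in>Q. \<exists>A\<in>P. B \<subseteq> A))"
  proof induction
    case base
    show ?case using P by (auto simp: partition_on_def disjoint_def)
  next
    case (step Q Q')
    note part = slink_step_partition[OF conjunct1[OF step.IH] step.hyps(2)]
    show ?case
    proof (intro conjI impI ballI)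
      show "partition_on {..<m} Q'" by (rule part)
      fix B assume "card P \<le> card Q'" "B \<in> Q'"
      then show "\<exists>A\<in>P. B \<subseteq> A"
        using slink_step_refines[OF P conjunct1[OF step.IH] _ _ e sep step.hyps(2)] step.IH part(2)
        by (simp add: less_Suc_eq_le)
    qed
  qed
  then show ?thesis
    using card by (intro refining_partition_card_eq[OF P]) auto
qed

text \<open>Together with \<open>d_I < d_H\<close> this makes \<open>d_H\<close> positive, so that
  one may divide by it.\<close>

lemma d_I_nonneg:
  assumes P: "partition_on {..<m} P" "P \<noteq> {}" and d: "\<And>i j. i < m \<Longrightarrow> j < m \<Longrightarrow> 0 \<le> d i j"
  shows "0 \<le> d_I d P"
proof -
  obtain A where A: "A \<in> P" using P by auto
  have finP: "finite P" using P(1) by (rule finite_elements[rotated]) simp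
  note bl = partition_on_finite_block[OF P(1) A]
  have "0 \<le> d_I_cluster d A"
  proof (cases "card A = 1")
    case False
    from bl obtain x where "x \<in> A" by auto
    with False have "A - {x} \<noteq> {}" by (auto simp: card_1_singleton_iff)
    then have "finite A" "{x} \<noteq> {}" "A - {x} \<noteq> {}" "{x} \<inter> (A - {x}) = {}" "{x} \<union> (A - {x}) = A"
      using bl \<open>x \<in> A\<close> by auto
    then obtain i j where ij: "i \<in> {x}" "j \<in> A - {x}" "d i j \<le> d_I_cluster d A"
      by (rule d_I_cluster_split)
    then have "i < m" "j < m" using bl \<open>x \<in> A\<close> by auto
    from d[OF this] ij show ?thesis by linarith
  qed (simp add: d_I_cluster_def)
  also have "\<dots> \<le> d_I d P" unfolding d_I_def using A finP by (intro Max_ge) auto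
  finally show ?thesis .
qed

subsection \<open>The stopping time\<close>

text \<open>The number of times at which \<open>gap\<close> misbehaves bounds the delay of the first passage, since
  an interval longer than that number contains a good time.\<close>

lemma first_passage_error_le:
  fixes gap :: "nat \<Rightarrow> real" and C D e b :: real and L :: nat
  defines "stop \<equiv> \<lambda>n. 2 \<le> n \<and> C / sqrt (real n) \<le> gap n"
  assumes fin: "finite Bad" and good: "\<And>n. n \<notin> Bad \<Longrightarrow> \<bar>gap n - D\<bar> \<le> e"
    and e: "0 < e" "e < D" and C: "0 < C" and gap: "\<And>n. gap n \<le> b" and b: "0 \<le> b" "b * sqrt L < C"
  shows "\<exists>n. stop n"
    and "\<bar>real (LEAST n. stop n) / C\<^sup>2 - 1 / D\<^sup>2\<bar> \<le> 1 / (D - e)\<^sup>2 - 1 / (D + e)\<^sup>2 + 3 / C\<^sup>2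
      + card Bad / C\<^sup>2 + card {n. n + L \<in> Bad} / D\<^sup>2"
proof -
  \<comment> \<open>From \<open>(C / (D - e))\<^sup>2\<close> on, the threshold is at most
    \<open>D - e\<close>. Rounding up costs at most 1 and the requirement \<open>2 \<le> n\<close>
    another 2, hence the 3 in the bound.\<close>
  define n1 where "n1 = nat \<lceil>(C / (D - e))\<^sup>2\<rceil> + 2"
  have n1: "(C / (D - e))\<^sup>2 \<le> n1" "n1 \<le> (C / (D - e))\<^sup>2 + 3"
    unfolding n1_def by (simp_all, linarith+)
  have "\<not> {n1..n1 + card Bad} \<subseteq> Bad"
    using card_mono[OF fin, of "{n1..n1 + card Bad}"] by auto
  then obtain n where n: "n1 \<le> n" "n \<le> n1 + card Bad" "n \<notin> Bad"
    by (auto simp: subset_iff)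
  have "stop n"
    unfolding stop_def
  proof
    show n2: "2 \<le> n" using n n1_def by simp
    have "(C / (D - e))\<^sup>2 \<le> n" using n n1 by linarith
    then have "C / (D - e) \<le> sqrt n" using real_le_rsqrt by blast
    then have "C / sqrt n \<le> D - e" using e C n2 by (simp add: field_simps)
    also have "\<dots> \<le> gap n" using good[OF n(3)] by linarith
    finally show "C / sqrt n \<le> gap n" .
  qed
  then show ex: "\<exists>n. stop n" ..
  define N where "N = (LEAST n. stop n)"
  have N: "stop N" "N \<le> n"
    unfolding N_def using \<open>stop n\<close> by (auto intro: LeastI Least_le)
  then have N2: "2 \<le> N" and "C / sqrt N \<le> gap N" by (auto simp: stop_def)
  then have CN: "C \<le> gap N * sqrt N" by (simp add: field_simps)
  \<comment> \<open>Before time \<open>L\<close> the threshold exceeds the uniform bound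
    \<open>b\<close> of the gap.\<close>
  have "L \<le> N"
  proof (rule ccontr)
    assume "\<not> L \<le> N"
    then have "gap N * sqrt N \<le> b * sqrt L"
      using gap[of N] b by (intro mult_mono) auto
    with CN b show False by linarith
  qed
  have "real N \<le> (C / (D - e))\<^sup>2 + 3 + card Bad"
    using N n n1(2) by linarith
  then have "N / C\<^sup>2 \<le> ((C / (D - e))\<^sup>2 + 3 + card Bad) / C\<^sup>2"
    using C by (intro divide_right_mono) auto
  also have "\<dots> = 1 / (D - e)\<^sup>2 + 3 / C\<^sup>2 + card Bad / C\<^sup>2"
    using C e by (simp add: field_simps)
  finally have up: "N / C\<^sup>2 \<le> 1 / (D - e)\<^sup>2 + 3 / C\<^sup>2 + card Bad / C\<^sup>2" .
  have mono: "1 / (D + e)\<^sup>2 \<le> 1 / D\<^sup>2" "1 / D\<^sup>2 \<le> 1 / (D - e)\<^sup>2"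
    using e by (auto intro!: divide_left_mono power_mono)
  have W: "0 \<le> card {n. n + L \<in> Bad} / D\<^sup>2" "0 \<le> 3 / C\<^sup>2 + card Bad / C\<^sup>2" by simp_all
  \<comment> \<open>Stopping at a good time forces \<open>C \<le> (D + e) * sqrt N\<close>. At a bad
    time the trivial error \<open>1 / D\<^sup>2\<close> is paid for by the number of bad times from
    \<open>L\<close> on, which is then at least 1.\<close>
  have low: "1 / D\<^sup>2 - N / C\<^sup>2 \<le> 1 / (D - e)\<^sup>2 - 1 / (D + e)\<^sup>2 + card {n. n + L \<in> Bad} / D\<^sup>2"
  proof (cases "N \<in> Bad")
    case False
    have "C \<le> gap N * sqrt N" by (rule CN)
    also have "\<dots> \<le> (D + e) * sqrt N"
      using good[OF False] by (intro mult_right_mono) auto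
    finally have "C\<^sup>2 \<le> ((D + e) * sqrt N)\<^sup>2" using C by (intro power_mono) auto
    then have "C\<^sup>2 \<le> (D + e)\<^sup>2 * N" by (simp add: power_mult_distrib)
    then have "1 / (D + e)\<^sup>2 \<le> N / C\<^sup>2" using C e by (simp add: field_simps)
    with mono W show ?thesis by linarith
  next
    case True
    have "finite {n. n + L \<in> Bad}"
      using finite_vimageI[OF fin, of "\<lambda>n. n + L"] by (simp add: vimage_def inj_def)
    moreover have "N - L \<in> {n. n + L \<in> Bad}" using True \<open>L \<le> N\<close> by simp
    ultimately have "1 \<le> card {n. n + L \<in> Bad}" by (metis One_nat_def Suc_leI card_gt_0_iff empty_iff)
    then have "1 / D\<^sup>2 \<le> card {n. n + L \<in> Bad} / D\<^sup>2" by (intro divide_right_mono) auto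
    moreover have "0 \<le> N / C\<^sup>2" by simp
    ultimately show ?thesis using mono by linarith
  qed
  show "\<bar>real (LEAST n. stop n) / C\<^sup>2 - 1 / D\<^sup>2\<bar> \<le> 1 / (D - e)\<^sup>2 - 1 / (D + e)\<^sup>2 + 3 / C\<^sup>2
      + card Bad / C\<^sup>2 + card {n. n + L \<in> Bad} / D\<^sup>2"
    unfolding N_def[symmetric] using up low mono W by linarith
qed

text \<open>The pathwise bound is integrated, and the expected number of bad times is the sum of
  their probabilities. No measurability of \<open>N\<close> is assumed: its error is only compared
  with a measurable majorant.\<close>

lemma (in prob_space) nn_integral_stop_error_le:
  assumes Bad [measurable]: "\<And>n. Bad n \<in> events" and summ: "summable (\<lambda>n. prob (Bad n))"
    and N: "\<And>\<omega>. \<omega> \<in> space M \<Longrightarrow> N \<omega> = (if \<exists>n. stop \<omega> n then enat (LEAST n. stop \<omega> n) else \<infinity>)"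
    and stop: "\<And>\<omega> n. stop \<omega> n \<longleftrightarrow> 2 \<le> n \<and> C / sqrt (real n) \<le> gap \<omega> n"
    and good: "\<And>\<omega> n. \<omega> \<in> space M \<Longrightarrow> \<omega> \<notin> Bad n \<Longrightarrow> \<bar>gap \<omega> n - D\<bar> \<le> e"
    and e: "0 < e" "e < D" and C: "0 < C"
    and gap: "\<And>\<omega> n. \<omega> \<in> space M \<Longrightarrow> gap \<omega> n \<le> b" and b: "0 \<le> b" "b * sqrt (real L) < C"
  shows "(\<integral>\<^sup>+ \<omega>. stop_error (N \<omega>) C D \<partial>M) \<le> ennreal (1 / (D - e)\<^sup>2 - 1 / (D + e)\<^sup>2 + 3 / C\<^sup>2
      + (\<Sum>n. prob (Bad n)) / C\<^sup>2 + (\<Sum>n. prob (Bad (n + L))) / D\<^sup>2)"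
proof -
  define A where "A = 1 / (D - e)\<^sup>2 - 1 / (D + e)\<^sup>2 + 3 / C\<^sup>2"
  have "1 / (D + e)\<^sup>2 \<le> 1 / (D - e)\<^sup>2"
    using e by (intro divide_left_mono power_mono) auto
  then have A: "0 \<le> A" by (simp add: A_def)
  have count: "(\<Sum>n. indicator (Bad (n + l)) \<omega>) = ennreal (card {n. n + l \<in> {n. \<omega> \<in> Bad n}})"
    if "finite {n. \<omega> \<in> Bad n}" for \<omega> l
  proof -
    have fin: "finite {n. n + l \<in> {n. \<omega> \<in> Bad n}}"
      using finite_vimageI[OF that, of "\<lambda>n. n + l"] by (simp add: vimage_def inj_def)
    have "(\<Sum>n. indicator (Bad (n + l)) \<omega> :: ennreal) = (\<Sum>n\<in>{n. n + l \<in> {n. \<omega> \<in> Bad n}}. indicator (Bad (n + l)) \<omega>)"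
      using fin by (intro suminf_finite) (auto simp: indicator_def)
    also have "\<dots> = (\<Sum>n\<in>{n. n + l \<in> {n. \<omega> \<in> Bad n}}. 1)"
      by (intro sum.cong) (auto simp: indicator_def)
    finally show ?thesis by (simp add: ennreal_of_nat_eq_real_of_nat)
  qed
  have shift: "summable (\<lambda>n. prob (Bad (n + l)))" for l
    using summ by (rule summable_ignore_initial_segment)
  have int: "(\<integral>\<^sup>+ \<omega>. (\<Sum>n. indicator (Bad (n + l)) \<omega>) \<partial>M) = ennreal (\<Sum>n. prob (Bad (n + l)))" for l
    using shift[of l] by (subst nn_integral_suminf) (auto simp: emeasure_eq_measure suminf_ennreal2)
  have lin: "ennreal A + ennreal (1 / C\<^sup>2) * ennreal v + ennreal (1 / D\<^sup>2) * ennreal w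
      = ennreal (A + 1 / C\<^sup>2 * v + 1 / D\<^sup>2 * w)" if "0 \<le> v" "0 \<le> w" for v w
  proof -
    have nn: "0 \<le> 1 / C\<^sup>2" "0 \<le> 1 / D\<^sup>2" by simp_all
    note mult = mult_nonneg_nonneg[OF nn(1) that(1)] mult_nonneg_nonneg[OF nn(2) that(2)]
    show ?thesis
      unfolding ennreal_plus[OF add_nonneg_nonneg[OF A mult(1)] mult(2)] ennreal_plus[OF A mult(1)]
        ennreal_mult[OF nn(1) that(1)] ennreal_mult[OF nn(2) that(2)] ..
  qed
  \<comment> \<open>By Borel--Cantelli almost every path has finitely many bad times, so
    \<open>first_passage_error_le\<close> applies and \<open>N\<close> is finite there.\<close>
  have "AE \<omega> in M. \<forall>\<^sub>F n in sequentially. \<omega> \<in> space M - Bad n"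
    using summ by (intro borel_cantelli_AE1) (auto simp: less_top[symmetric])
  \<comment> \<open>Writing \<open>n + 0\<close> puts both series into the shape of
    \<open>count\<close>.\<close>
  then have "AE \<omega> in M. stop_error (N \<omega>) C D \<le> ennreal A + ennreal (1 / C\<^sup>2) * (\<Sum>n. indicator (Bad (n + 0)) \<omega>)
      + ennreal (1 / D\<^sup>2) * (\<Sum>n. indicator (Bad (n + L)) \<omega>)"
  proof (rule AE_mp, intro AE_I2 impI)
    fix \<omega> assume \<omega>: "\<omega> \<in> space M" and ev: "\<forall>\<^sub>F n in sequentially. \<omega> \<in> space M - Bad n"
    then obtain n0 where "\<And>n. n0 \<le> n \<Longrightarrow> \<omega> \<notin> Bad n" by (auto simp: eventually_sequentially)
    then have "{n. \<omega> \<in> Bad n} \<subseteq> {..<n0}" by (metis lessThan_iff mem_Collect_eq not_le subsetI)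
    then have fin: "finite {n. \<omega> \<in> Bad n}" by (rule finite_subset) simp
    have good': "\<bar>gap \<omega> n - D\<bar> \<le> e" if "n \<notin> {n. \<omega> \<in> Bad n}" for n
      using good[OF \<omega>] that by auto
    note bound = first_passage_error_le[of "{n. \<omega> \<in> Bad n}" "gap \<omega>", OF fin good' e C gap[OF \<omega>] b, folded stop]
    have "stop_error (N \<omega>) C D = ennreal \<bar>real (LEAST n. stop \<omega> n) / C\<^sup>2 - 1 / D\<^sup>2\<bar>"
      using bound(1) by (simp add: N[OF \<omega>] stop_error_def)
    also have "\<dots> \<le> ennreal (A + 1 / C\<^sup>2 * card {n. n + 0 \<in> {n. \<omega> \<in> Bad n}} + 1 / D\<^sup>2 * card {n. n + L \<in> {n. \<omega> \<in> Bad n}})"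
      using bound(2) by (intro ennreal_leI) (simp add: A_def)
    also have "\<dots> = ennreal A + ennreal (1 / C\<^sup>2) * (\<Sum>n. indicator (Bad (n + 0)) \<omega>)
      + ennreal (1 / D\<^sup>2) * (\<Sum>n. indicator (Bad (n + L)) \<omega>)"
      unfolding count[OF fin] by (rule lin[symmetric]) auto
    finally show "stop_error (N \<omega>) C D \<le> ennreal A + ennreal (1 / C\<^sup>2) * (\<Sum>n. indicator (Bad (n + 0)) \<omega>)
      + ennreal (1 / D\<^sup>2) * (\<Sum>n. indicator (Bad (n + L)) \<omega>)" .
  qed
  then have "(\<integral>\<^sup>+ \<omega>. stop_error (N \<omega>) C D \<partial>M) \<le> (\<integral>\<^sup>+ \<omega>. ennreal A + ennreal (1 / C\<^sup>2) * (\<Sum>n. indicator (Bad (n + 0)) \<omega>)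
      + ennreal (1 / D\<^sup>2) * (\<Sum>n. indicator (Bad (n + L)) \<omega>) \<partial>M)"
    by (rule nn_integral_mono_AE)
  also have "\<dots> = ennreal A + ennreal (1 / C\<^sup>2) * ennreal (\<Sum>n. prob (Bad (n + 0)))
      + ennreal (1 / D\<^sup>2) * ennreal (\<Sum>n. prob (Bad (n + L)))"
    by (simp add: nn_integral_add nn_integral_cmult int[of 0, simplified] int emeasure_space_1)
  also have "\<dots> = ennreal (A + 1 / C\<^sup>2 * (\<Sum>n. prob (Bad (n + 0))) + 1 / D\<^sup>2 * (\<Sum>n. prob (Bad (n + L))))"
    by (intro lin suminf_nonneg shift) auto
  finally show ?thesis by (simp add: A_def)
qed

text \<open>The constants are chosen in the order \<open>e\<close>, \<open>L\<close>,
  \<open>C\<close>: the tolerance fixes the bad events, summability makes their tail from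
  \<open>L\<close> on small, and \<open>C\<close> is then large relative to both.\<close>

theorem theorem4:
  fixes M :: "'w measure" and S :: "'x measure"
    and X :: "nat \<Rightarrow> nat \<Rightarrow> 'w \<Rightarrow> 'x" and p :: "nat \<Rightarrow> 'x measure"
    and m K :: nat and P :: "nat set set"
    and k :: "'x \<Rightarrow> 'x \<Rightarrow> real" and G :: real
    and sel :: "(nat \<Rightarrow> nat \<Rightarrow> real) \<Rightarrow> nat set set"
  assumes prob: "prob_space M"
    and indep: "prob_space.indep_vars M (\<lambda>_. S) (\<lambda>(i, l). X i l) ({..<m} \<times> UNIV)"
    and distr: "\<And>i l. i < m \<Longrightarrow> distr M S (X i l) = p i"
    and m2: "m \<ge> 2" and K2: "K \<ge> 2"
    and P_sub: "P \<subseteq> Pow {..<m}" and P_cover: "\<Union>P = {..<m}"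
    and P_ne: "{} \<notin> P" and P_disj: "\<And>A B. A \<in> P \<Longrightarrow> B \<in> P \<Longrightarrow> A \<noteq> B \<Longrightarrow> A \<inter> B = {}"
    and P_card: "card P = K"
    and k_meas: "(\<lambda>(x, y). k x y) \<in> borel_measurable (S \<Otimes>\<^sub>M S)"
    and k_pd: "pd_kernel k"
    and k_bnd: "\<And>x y. 0 \<le> k x y \<and> k x y \<le> G"
    and sel: "\<And>\<delta>. slink_output \<delta> m K (sel \<delta>)"
    and sep: "d_I (\<lambda>i j. mmd k (p i) (p j)) P < d_H (\<lambda>i j. mmd k (p i) (p j)) P"
  shows "((\<lambda>C. \<integral>\<^sup>+ \<omega>. stop_error (slink_seq_N k X sel C \<omega>) C
                        (d_H (\<lambda>i j. mmd k (p i) (p j)) P) \<partial>M) \<longlongrightarrow> 0) at_top"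
proof -
  interpret kernel_sequences M S X p m k G
    using prob indep distr k_meas k_pd k_bnd
    by (intro kernel_sequences.intro iid_sequences.intro iid_sequences_axioms.intro kernel_sequences_axioms.intro)
  let ?d = "\<lambda>i j. mmd k (p i) (p j)"
  define D where "D = d_H ?d P"
  define gap where "gap \<omega> n = slink_gap (dhat k X n \<omega>) (sel (dhat k X n \<omega>))" for \<omega> n
  have part: "partition_on {..<m} P"
    using P_cover P_ne P_disj by (auto simp: partition_on_def disjoint_def)
  have "P \<noteq> {}" using P_card K2 by auto
  have "0 \<le> d_I ?d P"
    using mmd_eq_kernel_distance kernel_distance_nonneg by (intro d_I_nonneg[OF part \<open>P \<noteq> {}\<close>]) simp
  with sep have "0 < D" by (simp add: D_def)
  have gap_le: "gap \<omega> n \<le> sqrt (2 * G)" for \<omega> n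
  proof -
    note out = slink_output_partition[OF sel[of "dhat k X n \<omega>"]]
    from out K2 have "2 \<le> card (sel (dhat k X n \<omega>))" by simp
    then show ?thesis
      unfolding gap_def
      by (rule slink_gap_attained[OF out(1), where \<delta> = "dhat k X n \<omega>"]) (simp add: dhat_le)
  qed
  define Bad where "Bad e n = (\<Union>(i, j)\<in>{..<m} \<times> {..<m}. {\<omega> \<in> space M. e \<le> \<bar>dhat k X n \<omega> i j - ?d i j\<bar>})" for e n
  have dhat_tendsto: "completely_tendsto (\<lambda>n \<omega>. dhat k X n \<omega> i j) (?d i j)" if "i < m" "j < m" for i j
    using dhat_completely_tendsto[OF that] mmd_eq_kernel_distance[OF that] by simp
  have ev: "{\<omega> \<in> space M. e \<le> \<bar>dhat k X n \<omega> i j - ?d i j\<bar>} \<in> events" if "i < m" "j < m" for i j e n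
    using completely_tendsto_measurable[OF dhat_tendsto[OF that]] by measurable
  have Bad_meas: "Bad e n \<in> events" for e n
    unfolding Bad_def using ev by auto
  have Bad_summable: "summable (\<lambda>n. prob (Bad e n))" if "0 < e" for e
  proof (rule summable_comparison_test')
    let ?f = "\<lambda>n (i, j). prob {\<omega> \<in> space M. e \<le> \<bar>dhat k X n \<omega> i j - ?d i j\<bar>}"
    show "summable (\<lambda>n. \<Sum>ij\<in>{..<m} \<times> {..<m}. ?f n ij)"
      using dhat_tendsto that by (intro summable_sum) (auto simp: completely_tendsto_def)
    fix n
    have "prob (Bad e n) \<le> (\<Sum>ij\<in>{..<m} \<times> {..<m}. prob (case ij of (i, j) \<Rightarrow> {\<omega> \<in> space M. e \<le> \<bar>dhat k X n \<omega> i j - ?d i j\<bar>}))"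
      unfolding Bad_def using ev by (intro finite_measure_subadditive_finite) auto
    then show "norm (prob (Bad e n)) \<le> (\<Sum>ij\<in>{..<m} \<times> {..<m}. ?f n ij)"
      by (simp add: case_prod_beta)
  qed
  have good: "\<bar>gap \<omega> n - D\<bar> \<le> e"
    if "d_I ?d P + 2 * e < D" "\<omega> \<in> space M" "\<omega> \<notin> Bad e n" for \<omega> n e
  proof -
    have close: "\<bar>dhat k X n \<omega> i j - ?d i j\<bar> \<le> e" if "i < m" "j < m" for i j
      using \<open>\<omega> \<notin> Bad e n\<close> \<open>\<omega> \<in> space M\<close> that by (force simp: Bad_def)
    \<comment> \<open>The margin \<open>2 * e\<close> absorbs an error \<open>e\<close> in the short
      links and another in the long ones, so any tie-breaking returns the true clusters.\<close>
    have "sel (dhat k X n \<omega>) = P"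
      using sel[of "dhat k X n \<omega>"] P_card that(1)
      by (intro slink_output_eq[OF part _ close]) (auto simp: D_def)
    then show ?thesis
      using slink_gap_perturb[OF part _ close] K2 P_card by (simp add: gap_def D_def d_H_eq_slink_gap)
  qed
  show ?thesis
    unfolding D_def[symmetric]
  proof (rule order_tendstoI)
    fix a :: ennreal assume "0 < a"
    \<comment> \<open>\<open>a\<close> may be infinite, so a real \<open>\<eta>\<close> is placed
      below it; each of the four error terms will get a quarter of \<open>\<eta>\<close>.\<close>
    then obtain a' where "0 < a'" "a' < a" using dense by blast
    then obtain \<eta> where \<eta>: "0 < \<eta>" "ennreal \<eta> < a"
      by (cases a') auto
    have "((\<lambda>e. 1 / (D - e)\<^sup>2 - 1 / (D + e)\<^sup>2) \<longlongrightarrow> 1 / (D - 0)\<^sup>2 - 1 / (D + 0)\<^sup>2) (at_right 0)"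
      using \<open>0 < D\<close> by (intro tendsto_intros) auto
    then have "\<forall>\<^sub>F e in at_right 0. 1 / (D - e)\<^sup>2 - 1 / (D + e)\<^sup>2 < \<eta> / 4"
      by (rule order_tendstoD) (use \<eta> in simp)
    moreover have "\<forall>\<^sub>F e in at_right 0. 0 < e \<and> e < min D ((D - d_I ?d P) / 2)"
      using \<open>0 < D\<close> sep by (intro eventually_conj eventually_at_right_less eventually_at_rightI[of 0 "min D ((D - d_I ?d P) / 2)"]) (auto simp: D_def)
    ultimately have "\<forall>\<^sub>F e in at_right 0. 1 / (D - e)\<^sup>2 - 1 / (D + e)\<^sup>2 < \<eta> / 4 \<and> 0 < e \<and> e < min D ((D - d_I ?d P) / 2)"
      by (rule eventually_conj)
    then obtain e where e: "1 / (D - e)\<^sup>2 - 1 / (D + e)\<^sup>2 < \<eta> / 4" "0 < e" "e < D" "d_I ?d P + 2 * e < D"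
      by (auto dest!: eventually_happens simp: field_simps)
    \<comment> \<open>The factor \<open>D\<^sup>2\<close> anticipates the division in the tail
      term.\<close>
    have "0 < \<eta> / 4 * D\<^sup>2" using \<eta> \<open>0 < D\<close> by simp
    from suminf_exist_split[OF this Bad_summable[OF e(2)]]
    obtain L where "norm (\<Sum>n. prob (Bad e (n + L))) < \<eta> / 4 * D\<^sup>2" by blast
    then have "(\<Sum>n. prob (Bad e (n + L))) < \<eta> / 4 * D\<^sup>2"
      unfolding real_norm_def by (rule order_le_less_trans[OF abs_ge_self])
    then have L: "(\<Sum>n. prob (Bad e (n + L))) / D\<^sup>2 < \<eta> / 4"
      using \<open>0 < D\<close> by (simp only: pos_divide_less_eq zero_less_power)
    have "((\<lambda>C. c / C\<^sup>2) \<longlongrightarrow> 0) at_top" for c :: real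
      by real_asymp
    then have small: "\<forall>\<^sub>F C in at_top. c / C\<^sup>2 < \<eta> / 4" for c
      by (rule order_tendstoD) (use \<eta> in simp)
    show "\<forall>\<^sub>F C in at_top. (\<integral>\<^sup>+ \<omega>. stop_error (slink_seq_N k X sel C \<omega>) C D \<partial>M) < a"
      using small[of 3] small[of "\<Sum>n. prob (Bad e n)"] eventually_gt_at_top[of 0]
        eventually_gt_at_top[of "sqrt (2 * G) * sqrt L"]
    proof eventually_elim
      case (elim C)
      have "(\<integral>\<^sup>+ \<omega>. stop_error (slink_seq_N k X sel C \<omega>) C D \<partial>M) \<le> ennreal (1 / (D - e)\<^sup>2 - 1 / (D + e)\<^sup>2 + 3 / C\<^sup>2
          + (\<Sum>n. prob (Bad e n)) / C\<^sup>2 + (\<Sum>n. prob (Bad e (n + L))) / D\<^sup>2)"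
        by (rule nn_integral_stop_error_le[where gap = gap and b = "sqrt (2 * G)"
              and stop = "\<lambda>\<omega> n. 2 \<le> n \<and> C / sqrt (real n) \<le> gap \<omega> n"])
           (use e elim G_nonneg gap_le good Bad_meas Bad_summable in \<open>auto simp: slink_seq_N_def gap_def Let_def\<close>)
      also have "\<dots> \<le> ennreal \<eta>"
        using e(1) L elim by (intro ennreal_leI) linarith
      finally show ?case using \<eta>(2) by (rule order_le_less_trans)
    qed
  \<comment> \<open>The lower half of the limit is vacuous, since no extended nonnegative real lies
    below 0.\<close>
  qed simp
qed

end
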